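(* Let $G$ be a finite group. For a positive integer $n$ let $x_n\in\tilde B(G)$ be the element of the ghost ring of $G$ defined, for every subgroup $U\le G$, by $$x_n(U)=\begin{cases} n, & \text{if } U \text{ is cyclic},\\ 0, & \text{otherwise.}\end{cases}$$ Let $\mathcal U$ be the family of all cyclic subgroups of $G$ and let $A(G,\mathcal U)=\min\{n\in\mathbb N : n\ge 1,\ x_n\in B(G)\}$ be the Artin exponent of $G$. Then $A(G,\mathcal U)=1$ if and only if $G$ is cyclic.
   Context: For a finite group $G$, the Burnside ring $B(G)$ is the Grothendieck ring of the commutative semiring of isomorphism classes of finite left $G$-sets, with addition given by disjoint union and multiplication by cartesian product. For each subgroup $U\le G$, the map sending a finite $G$-set $S$ to the number of $U$-fixed points $\#\{s\in S : us=s \text{ for all } u\in U\}$ induces a ring homomorphism $\chi_U:B(G)\to\mathbb Z$. One has $\chi_U=\chi_V$ if and only if $U$ and $V$ are conjugate in $G$. The ghost ring $\tilde B(G)$ is the product $\prod\mathbb Z$ indexed by the conjugacy classes of subgroups of $G$, i.e. the ring of all functions from the set of subgroups of $G$ to $\mathbb Z$ that are constant on $G$-conjugacy classes, with pointwise operations. The product map $\prod_U\chi_U:B(G)\to\tilde B(G)$ is injective, and $B(G)$ is identified with its image: $x\in B(G)$ corresponds to the function $U\mapsto\chi_U(x)$. One has $|G|\cdot\tilde B(G)\subseteq B(G)$, so the minimum defining $A(G,\mathcal U)$ exists. *)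

theory Defs
  imports "HOL-Algebra.Group_Action" "HOL-Algebra.Elementary_Groups" "HOL-Algebra.Ring"
    "HOL-Library.Nat_Bijection"
begin

section \<open>Finite \<open>G\<close>-sets\<close>

text \<open>
  Isomorphism classes of all finite \<open>G\<close>-sets do not form a set, so the representatives are taken
  with carriers that are finite subsets of \<^typ>\<open>nat\<close>; lemma \<open>gset_on_nat\<close> below shows that every
  finite \<open>G\<close>-set is isomorphic to one of these.
\<close>

type_synonym 'a gset = "nat set \<times> ('a \<Rightarrow> nat \<Rightarrow> nat)"

definition gsets :: "('a, 'm) monoid_scheme \<Rightarrow> 'a gset set" where
  "gsets G = {(E, \<phi>). finite E \<and> group_action G E \<phi>}"

definition gset_iso ::
    "('a, 'm) monoid_scheme \<Rightarrow> 'b set \<times> ('a \<Rightarrow> 'b \<Rightarrow> 'b) \<Rightarrow> 'c set \<times> ('a \<Rightarrow> 'c \<Rightarrow> 'c) \<Rightarrow> bool" where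
  "gset_iso G = (\<lambda>(E, \<phi>) (F, \<psi>).
     \<exists>f. bij_betw f E F \<and> (\<forall>g \<in> carrier G. \<forall>x \<in> E. f (\<phi> g x) = \<psi> g (f x)))"

definition gset_rel :: "('a, 'm) monoid_scheme \<Rightarrow> ('a gset \<times> 'a gset) set" where
  "gset_rel G = {(S, T). S \<in> gsets G \<and> T \<in> gsets G \<and> gset_iso G S T}"

text \<open>
  The action on \<^term>\<open>f ` E\<close> obtained from an action on \<^term>\<open>E\<close> along an injection \<^term>\<open>f\<close>.
  The restriction is needed because \<^const>\<open>group_action\<close> requires extensional functions.
\<close>

definition transport :: "('b \<Rightarrow> 'c) \<Rightarrow> 'b set \<times> ('a \<Rightarrow> 'b \<Rightarrow> 'b) \<Rightarrow> 'c set \<times> ('a \<Rightarrow> 'c \<Rightarrow> 'c)" where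
  "transport f = (\<lambda>(E, \<phi>). (f ` E, \<lambda>g. \<lambda>y \<in> f ` E. f (\<phi> g (inv_into E f y))))"

definition dsum :: "'b set \<times> ('a \<Rightarrow> 'b \<Rightarrow> 'b) \<Rightarrow> 'c set \<times> ('a \<Rightarrow> 'c \<Rightarrow> 'c)
    \<Rightarrow> ('b + 'c) set \<times> ('a \<Rightarrow> 'b + 'c \<Rightarrow> 'b + 'c)" where
  "dsum = (\<lambda>(E, \<phi>) (F, \<psi>). (E <+> F, \<lambda>g. map_sum (\<phi> g) (\<psi> g)))"

definition cprod :: "'b set \<times> ('a \<Rightarrow> 'b \<Rightarrow> 'b) \<Rightarrow> 'c set \<times> ('a \<Rightarrow> 'c \<Rightarrow> 'c)
    \<Rightarrow> ('b \<times> 'c) set \<times> ('a \<Rightarrow> 'b \<times> 'c \<Rightarrow> 'b \<times> 'c)" where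
  "cprod = (\<lambda>(E, \<phi>) (F, \<psi>). (E \<times> F, \<lambda>g. map_prod (\<phi> g) (\<psi> g)))"

definition gset_sum :: "'a gset \<Rightarrow> 'a gset \<Rightarrow> 'a gset" where
  "gset_sum S T = transport sum_encode (dsum S T)"

definition gset_prod :: "'a gset \<Rightarrow> 'a gset \<Rightarrow> 'a gset" where
  "gset_prod S T = transport prod_encode (cprod S T)"

definition gset_zero :: "'a gset" where
  "gset_zero = ({}, \<lambda>g. \<lambda>x \<in> {}. x)"

definition gset_one :: "'a gset" where
  "gset_one = ({0}, \<lambda>g. \<lambda>x \<in> {0}. x)"

definition gset_semiring :: "('a, 'm) monoid_scheme \<Rightarrow> 'a gset set ring" where
  "gset_semiring G =
    \<lparr>carrier = gsets G // gset_rel G,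
     mult = (\<lambda>X Y. \<Union>S \<in> X. \<Union>T \<in> Y. gset_rel G `` {gset_prod S T}),
     one = gset_rel G `` {gset_one},
     zero = gset_rel G `` {gset_zero},
     add = (\<lambda>X Y. \<Union>S \<in> X. \<Union>T \<in> Y. gset_rel G `` {gset_sum S T})\<rparr>"


section \<open>The Grothendieck ring of a commutative semiring\<close>

text \<open>The pair \<open>(a, b)\<close> represents the formal difference \<open>a - b\<close>.\<close>

definition groth_rel :: "('s, 'm) ring_scheme \<Rightarrow> (('s \<times> 's) \<times> ('s \<times> 's)) set" where
  "groth_rel R = {((a, b), (c, d)).
     a \<in> carrier R \<and> b \<in> carrier R \<and> c \<in> carrier R \<and> d \<in> carrier R \<and>
     (\<exists>k \<in> carrier R. a \<oplus>\<^bsub>R\<^esub> d \<oplus>\<^bsub>R\<^esub> k = c \<oplus>\<^bsub>R\<^esub> b \<oplus>\<^bsub>R\<^esub> k)}"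

definition grothendieck_ring :: "('s, 'm) ring_scheme \<Rightarrow> ('s \<times> 's) set ring" where
  "grothendieck_ring R =
    \<lparr>carrier = (carrier R \<times> carrier R) // groth_rel R,
     mult = (\<lambda>X Y. \<Union>(a, b) \<in> X. \<Union>(c, d) \<in> Y.
       groth_rel R `` {(a \<otimes>\<^bsub>R\<^esub> c \<oplus>\<^bsub>R\<^esub> b \<otimes>\<^bsub>R\<^esub> d, a \<otimes>\<^bsub>R\<^esub> d \<oplus>\<^bsub>R\<^esub> b \<otimes>\<^bsub>R\<^esub> c)}),
     one = groth_rel R `` {(\<one>\<^bsub>R\<^esub>, \<zero>\<^bsub>R\<^esub>)},
     zero = groth_rel R `` {(\<zero>\<^bsub>R\<^esub>, \<zero>\<^bsub>R\<^esub>)},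
     add = (\<lambda>X Y. \<Union>(a, b) \<in> X. \<Union>(c, d) \<in> Y.
       groth_rel R `` {(a \<oplus>\<^bsub>R\<^esub> c, b \<oplus>\<^bsub>R\<^esub> d)})\<rparr>"


section \<open>The Burnside ring, its marks and the ghost ring\<close>

definition burnside_ring :: "('a, 'm) monoid_scheme \<Rightarrow> ('a gset set \<times> 'a gset set) set ring" where
  "burnside_ring G = grothendieck_ring (gset_semiring G)"

definition fixed_points :: "'a set \<Rightarrow> 'b set \<times> ('a \<Rightarrow> 'b \<Rightarrow> 'b) \<Rightarrow> 'b set" where
  "fixed_points U = (\<lambda>(E, \<phi>). {s \<in> E. \<forall>u \<in> U. \<phi> u s = s})"

text \<open>
  The common number of \<open>U\<close>-fixed points of the members of an isomorphism class, and its extension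
  to formal differences of classes. That these images are singletons is shown in lemmas
  \<open>class_mark_eq\<close> and \<open>mark_eq\<close>.
\<close>

definition class_mark :: "'a set \<Rightarrow> 'a gset set \<Rightarrow> nat" where
  "class_mark U X = the_elem ((\<lambda>S. card (fixed_points U S)) ` X)"

definition mark :: "'a set \<Rightarrow> ('a gset set \<times> 'a gset set) set \<Rightarrow> int" where
  "mark U x = the_elem ((\<lambda>(X, Y). int (class_mark U X) - int (class_mark U Y)) ` x)"

definition subgroups_of :: "('a, 'm) monoid_scheme \<Rightarrow> 'a set set" where
  "subgroups_of G = {U. subgroup U G}"

definition ghost_ring :: "('a, 'm) monoid_scheme \<Rightarrow> ('a set \<Rightarrow> int) ring" where
  "ghost_ring G =
    \<lparr>carrier = {x \<in> extensional (subgroups_of G).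
       \<forall>U \<in> subgroups_of G. \<forall>g \<in> carrier G. x (g <#\<^bsub>G\<^esub> U #>\<^bsub>G\<^esub> inv\<^bsub>G\<^esub> g) = x U},
     mult = (\<lambda>x y. \<lambda>U \<in> subgroups_of G. x U * y U),
     one = (\<lambda>U \<in> subgroups_of G. 1),
     zero = (\<lambda>U \<in> subgroups_of G. 0),
     add = (\<lambda>x y. \<lambda>U \<in> subgroups_of G. x U + y U)\<rparr>"

definition ghost_map ::
    "('a, 'm) monoid_scheme \<Rightarrow> ('a gset set \<times> 'a gset set) set \<Rightarrow> 'a set \<Rightarrow> int" where
  "ghost_map G x = (\<lambda>U \<in> subgroups_of G. mark U x)"

text \<open>The copy of the Burnside ring inside the ghost ring; see \<open>burnside_image_subset_ghost_ring\<close>.\<close>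

definition burnside_image :: "('a, 'm) monoid_scheme \<Rightarrow> ('a set \<Rightarrow> int) set" where
  "burnside_image G = ghost_map G ` carrier (burnside_ring G)"


section \<open>Artin exponents\<close>

definition cyclic_subgroups :: "('a, 'm) monoid_scheme \<Rightarrow> 'a set set" where
  "cyclic_subgroups G = {U \<in> subgroups_of G. cyclic_group (G\<lparr>carrier := U\<rparr>)}"

definition artin_element ::
    "('a, 'm) monoid_scheme \<Rightarrow> 'a set set \<Rightarrow> nat \<Rightarrow> 'a set \<Rightarrow> int" where
  "artin_element G \<U> n = (\<lambda>U \<in> subgroups_of G. if U \<in> \<U> then int n else 0)"

definition artin_exponent :: "('a, 'm) monoid_scheme \<Rightarrow> 'a set set \<Rightarrow> nat" where
  "artin_exponent G \<U> = (LEAST n. n \<ge> 1 \<and> artin_element G \<U> n \<in> burnside_image G)"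


section \<open>Well-definedness\<close>

definition pre_action ::
    "('a, 'm) monoid_scheme \<Rightarrow> 'b set \<times> ('a \<Rightarrow> 'b \<Rightarrow> 'b) \<Rightarrow> bool" where
  "pre_action G = (\<lambda>(E, \<phi>). (\<forall>g \<in> carrier G. \<forall>x \<in> E. \<phi> g x \<in> E) \<and> (\<forall>x \<in> E. \<phi> \<one>\<^bsub>G\<^esub> x = x) \<and>
     (\<forall>g \<in> carrier G. \<forall>h \<in> carrier G. \<forall>x \<in> E. \<phi> (g \<otimes>\<^bsub>G\<^esub> h) x = \<phi> g (\<phi> h x)))"

lemma gset_iso_refl: "gset_iso G S S"
  unfolding gset_iso_def by (cases S) (auto intro!: exI[of _ id])

lemma gset_iso_trans:
  assumes "gset_iso G S T" "gset_iso G T W"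
  shows "gset_iso G S W"
proof -
  obtain E \<phi> F \<psi> H \<theta> where S: "S = (E, \<phi>)" "T = (F, \<psi>)" "W = (H, \<theta>)"
    by (cases S, cases T, cases W)
  obtain f where f: "bij_betw f E F" "\<And>g x. g \<in> carrier G \<Longrightarrow> x \<in> E \<Longrightarrow> f (\<phi> g x) = \<psi> g (f x)"
    using assms(1) unfolding S gset_iso_def by auto
  obtain h where h: "bij_betw h F H" "\<And>g x. g \<in> carrier G \<Longrightarrow> x \<in> F \<Longrightarrow> h (\<psi> g x) = \<theta> g (h x)"
    using assms(2) unfolding S gset_iso_def by auto
  show ?thesis
    unfolding S gset_iso_def
    using bij_betw_trans[OF f(1) h(1)] f h by (auto intro!: exI[of _ "h \<circ> f"] dest: bij_betwE)
qed

lemma group_actionI: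
  assumes "group G"
    and ext: "\<And>g. g \<in> carrier G \<Longrightarrow> \<phi> g \<in> extensional E"
    and cl: "\<And>g x. g \<in> carrier G \<Longrightarrow> x \<in> E \<Longrightarrow> \<phi> g x \<in> E"
    and one: "\<And>x. x \<in> E \<Longrightarrow> \<phi> \<one>\<^bsub>G\<^esub> x = x"
    and mult: "\<And>g h x. g \<in> carrier G \<Longrightarrow> h \<in> carrier G \<Longrightarrow> x \<in> E \<Longrightarrow> \<phi> (g \<otimes>\<^bsub>G\<^esub> h) x = \<phi> g (\<phi> h x)"
  shows "group_action G E \<phi>"
proof -
  interpret group G by fact
  have Bij: "\<phi> g \<in> Bij E" if g: "g \<in> carrier G" for g
  proof -
    have "\<phi> (inv\<^bsub>G\<^esub> g) (\<phi> g x) = x" "\<phi> g (\<phi> (inv\<^bsub>G\<^esub> g) x) = x" if "x \<in> E" for x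
      using g that by (simp_all flip: mult add: one)
    then have "bij_betw (\<phi> g) E E"
      using g cl by (intro bij_betw_byWitness[where f' = "\<phi> (inv\<^bsub>G\<^esub> g)"]) auto
    then show ?thesis using ext g by (simp add: Bij_def)
  qed
  have "\<phi> (g \<otimes>\<^bsub>G\<^esub> h) = compose E (\<phi> g) (\<phi> h)" if "g \<in> carrier G" "h \<in> carrier G" for g h
    using that by (intro extensionalityI[of _ E]) (auto simp: ext mult compose_def)
  then have "\<phi> \<in> hom G (BijGroup E)"
    using Bij by (auto simp: hom_def BijGroup_def)
  then show ?thesis
    unfolding group_action_def group_hom_def group_hom_axioms_def
    using group_BijGroup assms(1) by auto
qed

lemma pre_action_group_action:
  assumes "group_action G E \<phi>"
  shows "pre_action G (E, \<phi>)"
proof -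
  interpret group_action G E \<phi> by fact
  have "\<phi> \<one>\<^bsub>G\<^esub> x = x" if "x \<in> E" for x
    using fun_cong[OF id_eq_one, of x] that by simp
  moreover have "\<phi> g x \<in> E" if "g \<in> carrier G" "x \<in> E" for g x
    using element_image[OF that refl] .
  ultimately show ?thesis
    by (simp add: pre_action_def composition_rule)
qed

lemma pre_action_gsets: "S \<in> gsets G \<Longrightarrow> pre_action G S"
  by (auto simp: gsets_def pre_action_group_action)

lemma gset_iso_sym:
  assumes "pre_action G S" "gset_iso G S T"
  shows "gset_iso G T S"
proof -
  obtain E \<phi> F \<psi> where ST: "S = (E, \<phi>)" "T = (F, \<psi>)" by (cases S, cases T)
  with assms(2) obtain f where f: "bij_betw f E F"
    and eq: "\<And>g x. g \<in> carrier G \<Longrightarrow> x \<in> E \<Longrightarrow> f (\<phi> g x) = \<psi> g (f x)"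
    unfolding gset_iso_def by auto
  have cl: "\<phi> g x \<in> E" if "g \<in> carrier G" "x \<in> E" for g x
    using assms(1) that ST by (auto simp: pre_action_def)
  have "inv_into E f (\<psi> g y) = \<phi> g (inv_into E f y)" if "g \<in> carrier G" "y \<in> F" for g y
  proof -
    have x: "inv_into E f y \<in> E" "f (inv_into E f y) = y"
      using f that by (auto simp: bij_betw_def inv_into_into f_inv_into_f)
    then have "\<psi> g y = f (\<phi> g (inv_into E f y))" using eq that by simp
    then show ?thesis using f cl[OF that(1) x(1)] by (simp add: bij_betw_def)
  qed
  then show ?thesis
    using bij_betw_inv_into[OF f] unfolding gset_iso_def ST by auto
qed

lemma equiv_gset_rel: "equiv (gsets G) (gset_rel G)"
  by (rule equivI)
     (auto simp: gset_rel_def refl_on_def sym_def trans_def gset_iso_refl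
        intro: gset_iso_sym pre_action_gsets gset_iso_trans)

lemma transport_action:
  assumes "group G" "pre_action G S" "inj_on f (fst S)"
  shows "group_action G (fst (transport f S)) (snd (transport f S))"
    and "gset_iso G S (transport f S)"
proof -
  interpret group G by fact
  obtain E \<phi> where S: "S = (E, \<phi>)" by (cases S)
  note A = assms(2,3)[unfolded S pre_action_def, simplified]
  show "group_action G (fst (transport f S)) (snd (transport f S))"
    using A by (intro group_actionI) (auto simp: transport_def S assms(1) inj_on_eq_iff)
  show "gset_iso G S (transport f S)"
    using A by (auto simp: gset_iso_def transport_def S bij_betw_def inj_on_eq_iff intro!: exI[of _ f])
qed

lemma gset_on_nat:
  fixes E :: "'b set"
  assumes "group G" "finite E" "group_action G E \<phi>"
  shows "\<exists>S \<in> gsets G. gset_iso G (E, \<phi>) S"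
proof -
  obtain f :: "'b \<Rightarrow> nat" where f: "inj_on f E"
    using finite_imp_inj_to_nat_seg[OF assms(2)] by auto
  have "transport f (E, \<phi>) \<in> gsets G"
    using transport_action(1)[OF assms(1) pre_action_group_action[OF assms(3)], of f] f assms(2)
    by (auto simp: gsets_def transport_def)
  moreover have "gset_iso G (E, \<phi>) (transport f (E, \<phi>))"
    using transport_action(2)[OF assms(1) pre_action_group_action[OF assms(3)], of f] f by simp
  ultimately show ?thesis by blast
qed

lemma dsum_cprod_action:
  assumes "pre_action G S" "pre_action G T"
  shows "pre_action G (dsum S T)" "pre_action G (cprod S T)"
  using assms by (auto simp: pre_action_def dsum_def cprod_def split: prod.splits)

lemma gset_sum_prod:
  assumes "group G" "S \<in> gsets G" "T \<in> gsets G"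
  shows "gset_sum S T \<in> gsets G" "gset_iso G (dsum S T) (gset_sum S T)"
    and "gset_prod S T \<in> gsets G" "gset_iso G (cprod S T) (gset_prod S T)"
proof -
  note P = dsum_cprod_action[OF assms(2,3)[THEN pre_action_gsets]]
  have i: "inj_on sum_encode A" "inj_on prod_encode B" for A B
    by (rule inj_sum_encode inj_prod_encode)+
  have "finite (fst (gset_sum S T))" "finite (fst (gset_prod S T))"
    using assms(2,3)
    by (auto simp: gsets_def gset_sum_def gset_prod_def transport_def dsum_def cprod_def)
  then show "gset_sum S T \<in> gsets G" "gset_prod S T \<in> gsets G"
    using transport_action(1)[OF assms(1) P(1) i(1)] transport_action(1)[OF assms(1) P(2) i(2)]
    by (simp_all add: gsets_def gset_sum_def gset_prod_def case_prod_beta)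
  show "gset_iso G (dsum S T) (gset_sum S T)" "gset_iso G (cprod S T) (gset_prod S T)"
    unfolding gset_sum_def gset_prod_def
    using transport_action(2)[OF assms(1) P(1) i(1)] transport_action(2)[OF assms(1) P(2) i(2)]
    by simp_all
qed

lemma gset_iso_dsum_cprod:
  assumes "gset_iso G S S'" "gset_iso G T T'"
  shows "gset_iso G (dsum S T) (dsum S' T')" "gset_iso G (cprod S T) (cprod S' T')"
proof -
  obtain E \<phi> F \<psi> E' \<phi>' F' \<psi>' where S: "S = (E, \<phi>)" "T = (F, \<psi>)" "S' = (E', \<phi>')" "T' = (F', \<psi>')"
    by (cases S, cases T, cases S', cases T')
  obtain f where f: "bij_betw f E E'" "\<And>g x. g \<in> carrier G \<Longrightarrow> x \<in> E \<Longrightarrow> f (\<phi> g x) = \<phi>' g (f x)"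
    using assms(1) unfolding S gset_iso_def by auto
  obtain h where h: "bij_betw h F F'" "\<And>g x. g \<in> carrier G \<Longrightarrow> x \<in> F \<Longrightarrow> h (\<psi> g x) = \<psi>' g (h x)"
    using assms(2) unfolding S gset_iso_def by auto
  have "bij_betw (map_sum f h) (E <+> F) (E' <+> F')"
  proof (rule bij_betw_imageI)
    show "inj_on (map_sum f h) (E <+> F)"
      using bij_betw_imp_inj_on[OF f(1)] bij_betw_imp_inj_on[OF h(1)]
      by (intro inj_onI) (auto simp: inj_on_eq_iff)
    have "map_sum f h ` (E <+> F) = f ` E <+> h ` F"
      by (simp add: Plus_def image_Un image_image)
    then show "map_sum f h ` (E <+> F) = E' <+> F'"
      using f(1) h(1) by (simp add: bij_betw_def)
  qed
  then show "gset_iso G (dsum S T) (dsum S' T')"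
    using f(2) h(2) unfolding S gset_iso_def dsum_def prod.case
    by (intro exI[of _ "map_sum f h"]) auto
  have "bij_betw (map_prod f h) (E \<times> F) (E' \<times> F')"
    using f(1) h(1) by (rule bij_betw_map_prod)
  then show "gset_iso G (cprod S T) (cprod S' T')"
    using f(2) h(2) unfolding S gset_iso_def cprod_def prod.case
    by (intro exI[of _ "map_prod f h"]) auto
qed

lemma gset_sum_prod_respects:
  assumes "group G" "(S, S') \<in> gset_rel G" "(T, T') \<in> gset_rel G"
  shows "(gset_sum S T, gset_sum S' T') \<in> gset_rel G"
    and "(gset_prod S T, gset_prod S' T') \<in> gset_rel G"
proof -
  have m: "S \<in> gsets G" "T \<in> gsets G" "S' \<in> gsets G" "T' \<in> gsets G"
    and i: "gset_iso G S S'" "gset_iso G T T'"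
    using assms by (auto simp: gset_rel_def)
  note P = gset_sum_prod[OF assms(1) m(1,2)] gset_sum_prod[OF assms(1) m(3,4)]
  note A = dsum_cprod_action[OF m(1,2)[THEN pre_action_gsets]]
  have "gset_iso G (gset_sum S T) (gset_sum S' T')"
    using gset_iso_trans[OF gset_iso_trans[OF gset_iso_sym[OF A(1) P(2)]
          gset_iso_dsum_cprod(1)[OF i]] P(6)] .
  then show "(gset_sum S T, gset_sum S' T') \<in> gset_rel G"
    using P by (simp add: gset_rel_def)
  have "gset_iso G (gset_prod S T) (gset_prod S' T')"
    using gset_iso_trans[OF gset_iso_trans[OF gset_iso_sym[OF A(2) P(4)]
          gset_iso_dsum_cprod(2)[OF i]] P(8)] .
  then show "(gset_prod S T, gset_prod S' T') \<in> gset_rel G"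
    using P by (simp add: gset_rel_def)
qed

lemma gset_semiring_ops:
  assumes "group G" "S \<in> gsets G" "T \<in> gsets G"
  shows "gset_rel G `` {S} \<oplus>\<^bsub>gset_semiring G\<^esub> gset_rel G `` {T} = gset_rel G `` {gset_sum S T}"
    and "gset_rel G `` {S} \<otimes>\<^bsub>gset_semiring G\<^esub> gset_rel G `` {T} = gset_rel G `` {gset_prod S T}"
proof -
  have "congruent2 (gset_rel G) (gset_rel G) (\<lambda>S T. gset_rel G `` {gset_sum S T})"
    "congruent2 (gset_rel G) (gset_rel G) (\<lambda>S T. gset_rel G `` {gset_prod S T})"
    unfolding congruent2_def
    using gset_sum_prod_respects[OF assms(1)] equiv_class_eq[OF equiv_gset_rel] by blast+
  then show "gset_rel G `` {S} \<oplus>\<^bsub>gset_semiring G\<^esub> gset_rel G `` {T} = gset_rel G `` {gset_sum S T}"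
    and "gset_rel G `` {S} \<otimes>\<^bsub>gset_semiring G\<^esub> gset_rel G `` {T} = gset_rel G `` {gset_prod S T}"
    using assms by (simp_all add: gset_semiring_def UN_equiv_class2[OF equiv_gset_rel equiv_gset_rel])
qed

lemma dsum_laws:
  "gset_iso G (dsum (dsum S T) W) (dsum S (dsum T W))"
  "gset_iso G (dsum S T) (dsum T S)"
  "gset_iso G (dsum gset_zero S) S"
proof -
  obtain E \<phi> F \<psi> H \<theta> where S: "S = (E, \<phi>)" "T = (F, \<psi>)" "W = (H, \<theta>)"
    by (cases S, cases T, cases W)
  show "gset_iso G (dsum (dsum S T) W) (dsum S (dsum T W))"
    unfolding S dsum_def gset_iso_def
    by (auto simp: bij_betw_def inj_on_def image_Un image_image Plus_def intro!:
        exI[of _ "case_sum (case_sum Inl (Inr \<circ> Inl)) (Inr \<circ> Inr)"])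
  show "gset_iso G (dsum S T) (dsum T S)"
    unfolding S dsum_def gset_iso_def
    by (auto simp: bij_betw_def inj_on_def image_Un image_image Plus_def intro!:
        exI[of _ "case_sum Inr Inl"])
  show "gset_iso G (dsum gset_zero S) S"
    unfolding S dsum_def gset_zero_def gset_iso_def
    by (auto simp: bij_betw_def inj_on_def image_Un image_image Plus_def intro!:
        exI[of _ "case_sum undefined id"])
qed

lemma gset_zero: "group G \<Longrightarrow> gset_zero \<in> gsets G"
  by (auto simp: gsets_def gset_zero_def intro!: group_actionI)

lemma gset_one: "group G \<Longrightarrow> gset_one \<in> gsets G"
  by (auto simp: gsets_def gset_one_def intro!: group_actionI)

lemma gset_sum_laws:
  assumes "group G" and m: "S \<in> gsets G" "T \<in> gsets G" "W \<in> gsets G"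
  shows "gset_iso G (gset_sum (gset_sum S T) W) (gset_sum S (gset_sum T W))"
    and "gset_iso G (gset_sum S T) (gset_sum T S)"
    and "gset_iso G (gset_sum gset_zero S) S"
proof -
  note P = gset_sum_prod[OF assms(1)]
  note A = dsum_cprod_action(1) pre_action_gsets
  have to: "gset_iso G (gset_sum X Y) (dsum X Y)" if "X \<in> gsets G" "Y \<in> gsets G" for X Y
    using gset_iso_sym[OF A(1)[OF A(2)[OF that(1)] A(2)[OF that(2)]] P(2)[OF that]] .
  have "gset_iso G (gset_sum (gset_sum S T) W) (dsum (dsum S T) W)"
    by (rule gset_iso_trans[OF to[OF P(1)] gset_iso_dsum_cprod(1)[OF to gset_iso_refl]])
       (use m in auto)
  moreover have "gset_iso G (dsum S (dsum T W)) (gset_sum S (gset_sum T W))"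
    by (rule gset_iso_trans[OF gset_iso_dsum_cprod(1)[OF gset_iso_refl P(2)] P(2)])
       (use m P in auto)
  ultimately show "gset_iso G (gset_sum (gset_sum S T) W) (gset_sum S (gset_sum T W))"
    using gset_iso_trans[OF gset_iso_trans[OF _ dsum_laws(1)]] by blast
  show "gset_iso G (gset_sum S T) (gset_sum T S)"
    by (rule gset_iso_trans[OF gset_iso_trans[OF to dsum_laws(2)] P(2)]) (use m in auto)
  show "gset_iso G (gset_sum gset_zero S) S"
    by (rule gset_iso_trans[OF to dsum_laws(3)]) (use m gset_zero[OF assms(1)] in auto)
qed

lemma gset_semiring_abelian_monoid:
  assumes "group G"
  shows "abelian_monoid (gset_semiring G)"
proof -
  let ?c = "\<lambda>S. gset_rel G `` {S}"
  note ops = gset_semiring_ops(1)[OF assms] gset_sum_prod(1)[OF assms]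
  have c: "carrier (gset_semiring G) = ?c ` gsets G"
    by (auto simp: gset_semiring_def quotient_def)
  have z: "\<zero>\<^bsub>gset_semiring G\<^esub> = ?c gset_zero"
    by (simp add: gset_semiring_def)
  have eq: "?c S = ?c T" if "S \<in> gsets G" "T \<in> gsets G" "gset_iso G S T" for S T
    using that by (intro equiv_class_eq[OF equiv_gset_rel]) (simp add: gset_rel_def)
  show ?thesis
  proof (rule abelian_monoidI; unfold c z)
    fix X Y Z
    assume "X \<in> ?c ` gsets G" "Y \<in> ?c ` gsets G"
    then obtain S T where S: "S \<in> gsets G" "X = ?c S" and T: "T \<in> gsets G" "Y = ?c T"
      by blast
    show "X \<oplus>\<^bsub>gset_semiring G\<^esub> Y \<in> ?c ` gsets G"
      unfolding S(2) T(2) ops(1)[OF S(1) T(1)] using ops(2)[OF S(1) T(1)] by (rule imageI)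
    show "X \<oplus>\<^bsub>gset_semiring G\<^esub> Y = Y \<oplus>\<^bsub>gset_semiring G\<^esub> X"
      unfolding S(2) T(2) ops(1)[OF S(1) T(1)] ops(1)[OF T(1) S(1)]
      by (rule eq[OF ops(2)[OF S(1) T(1)] ops(2)[OF T(1) S(1)]
            gset_sum_laws(2)[OF assms S(1) T(1) T(1)]])
    assume "Z \<in> ?c ` gsets G"
    then obtain W where W: "W \<in> gsets G" "Z = ?c W" by blast
    note ST = ops(2)[OF S(1) T(1)] and TW = ops(2)[OF T(1) W(1)]
    show "X \<oplus>\<^bsub>gset_semiring G\<^esub> Y \<oplus>\<^bsub>gset_semiring G\<^esub> Z =
        X \<oplus>\<^bsub>gset_semiring G\<^esub> (Y \<oplus>\<^bsub>gset_semiring G\<^esub> Z)"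
      unfolding S(2) T(2) W(2) ops(1)[OF S(1) T(1)] ops(1)[OF T(1) W(1)]
        ops(1)[OF ST W(1)] ops(1)[OF S(1) TW]
      by (rule eq[OF ops(2)[OF ST W(1)] ops(2)[OF S(1) TW]
            gset_sum_laws(1)[OF assms S(1) T(1) W(1)]])
  next
    note Z = gset_zero[OF assms]
    show "?c gset_zero \<in> ?c ` gsets G"
      using Z by (rule imageI)
    fix X assume "X \<in> ?c ` gsets G"
    then obtain S where S: "S \<in> gsets G" "X = ?c S" by blast
    show "?c gset_zero \<oplus>\<^bsub>gset_semiring G\<^esub> X = X"
      unfolding S(2) ops(1)[OF Z S(1)]
      by (rule eq[OF ops(2)[OF Z S(1)] S(1) gset_sum_laws(3)[OF assms S(1) S(1) S(1)]])
  qed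
qed

lemma fixed_points_iso:
  assumes "U \<subseteq> carrier G" "gset_iso G S T" "pre_action G S"
  shows "card (fixed_points U S) = card (fixed_points U T)"
proof -
  obtain E \<phi> F \<psi> where S: "S = (E, \<phi>)" "T = (F, \<psi>)" by (cases S, cases T)
  obtain f where f: "bij_betw f E F" "\<And>g x. g \<in> carrier G \<Longrightarrow> x \<in> E \<Longrightarrow> f (\<phi> g x) = \<psi> g (f x)"
    using assms(2) unfolding S gset_iso_def by auto
  have "f ` fixed_points U S = fixed_points U T"
  proof
    show "f ` fixed_points U S \<subseteq> fixed_points U T"
      using f assms(1) by (force simp: fixed_points_def S bij_betw_def)
    show "fixed_points U T \<subseteq> f ` fixed_points U S"
    proof
      fix y assume y: "y \<in> fixed_points U T"
      then obtain x where x: "x \<in> E" "y = f x"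
        using f(1) by (auto simp: fixed_points_def S bij_betw_def)
      have "\<phi> u x = x" if "u \<in> U" for u
      proof -
        have "f (\<phi> u x) = f x"
          using f(2) x y that assms(1) by (auto simp: fixed_points_def S)
        moreover have "\<phi> u x \<in> E"
          using assms that x by (auto simp: pre_action_def S)
        ultimately show ?thesis using inj_onD[OF bij_betw_imp_inj_on[OF f(1)]] x(1) by blast
      qed
      then show "y \<in> f ` fixed_points U S"
        using x by (auto simp: fixed_points_def S)
    qed
  qed
  moreover have "inj_on f (fixed_points U S)"
    using f(1) by (auto simp: bij_betw_def fixed_points_def S intro: inj_on_subset)
  ultimately show ?thesis using card_image by metis
qed

lemma fixed_points_sum:
  assumes "group G" "U \<subseteq> carrier G" "S \<in> gsets G" "T \<in> gsets G"
  shows "card (fixed_points U (gset_sum S T)) = card (fixed_points U S) + card (fixed_points U T)"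
proof -
  have "card (fixed_points U (gset_sum S T)) = card (fixed_points U (dsum S T))"
    using fixed_points_iso[OF assms(2) gset_sum_prod(2)[OF assms(1,3,4)]]
      dsum_cprod_action(1)[OF assms(3,4)[THEN pre_action_gsets]] by simp
  also have "fixed_points U (dsum S T) = fixed_points U S <+> fixed_points U T"
    by (auto simp: fixed_points_def dsum_def split: prod.splits)
  finally show ?thesis
    using assms(3,4) by (auto simp: card_Plus fixed_points_def gsets_def)
qed

lemma class_mark_eq:
  assumes "U \<subseteq> carrier G" "S \<in> gsets G"
  shows "(\<lambda>S. card (fixed_points U S)) ` (gset_rel G `` {S}) = {card (fixed_points U S)}"
    and "class_mark U (gset_rel G `` {S}) = card (fixed_points U S)"
proof -
  have "S \<in> gset_rel G `` {S}"
    using equiv_class_self[OF equiv_gset_rel assms(2)] .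
  moreover have "card (fixed_points U T) = card (fixed_points U S)" if "T \<in> gset_rel G `` {S}" for T
    using that fixed_points_iso[OF assms(1)] pre_action_gsets by (fastforce simp: gset_rel_def)
  ultimately show "(\<lambda>S. card (fixed_points U S)) ` (gset_rel G `` {S}) = {card (fixed_points U S)}"
    by blast
  then show "class_mark U (gset_rel G `` {S}) = card (fixed_points U S)"
    by (simp add: class_mark_def)
qed

lemma carrier_gset_semiring: "carrier (gset_semiring G) = (\<lambda>S. gset_rel G `` {S}) ` gsets G"
  by (auto simp: gset_semiring_def quotient_def)

lemma class_mark_add:
  assumes "group G" "U \<subseteq> carrier G" "X \<in> carrier (gset_semiring G)" "Y \<in> carrier (gset_semiring G)"
  shows "class_mark U (X \<oplus>\<^bsub>gset_semiring G\<^esub> Y) = class_mark U X + class_mark U Y"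
  using assms
  by (auto simp: carrier_gset_semiring class_mark_eq fixed_points_sum gset_semiring_ops gset_sum_prod)

lemma equiv_groth_rel:
  assumes "abelian_monoid R"
  shows "equiv (carrier R \<times> carrier R) (groth_rel R)"
proof (rule equivI)
  interpret abelian_monoid R by fact
  show "groth_rel R \<subseteq> (carrier R \<times> carrier R) \<times> (carrier R \<times> carrier R)"
    by (auto simp: groth_rel_def)
  show "refl_on (carrier R \<times> carrier R) (groth_rel R)"
    by (auto simp: refl_on_def groth_rel_def intro!: bexI[of _ "\<zero>\<^bsub>R\<^esub>"])
  show "sym (groth_rel R)"
    by (rule symI) (auto simp: groth_rel_def intro: sym)
  show "trans (groth_rel R)"
  proof (rule transI)
    fix x y z
    assume "(x, y) \<in> groth_rel R" "(y, z) \<in> groth_rel R"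
    then obtain a b c d e f k l where xyz: "x = (a, b)" "y = (c, d)" "z = (e, f)"
      and m: "a \<in> carrier R" "b \<in> carrier R" "c \<in> carrier R" "d \<in> carrier R"
        "e \<in> carrier R" "f \<in> carrier R" "k \<in> carrier R" "l \<in> carrier R"
      and k: "a \<oplus>\<^bsub>R\<^esub> d \<oplus>\<^bsub>R\<^esub> k = c \<oplus>\<^bsub>R\<^esub> b \<oplus>\<^bsub>R\<^esub> k" and l: "c \<oplus>\<^bsub>R\<^esub> f \<oplus>\<^bsub>R\<^esub> l = e \<oplus>\<^bsub>R\<^esub> d \<oplus>\<^bsub>R\<^esub> l"
      unfolding groth_rel_def by blast
    have "a \<oplus>\<^bsub>R\<^esub> f \<oplus>\<^bsub>R\<^esub> (d \<oplus>\<^bsub>R\<^esub> k \<oplus>\<^bsub>R\<^esub> l) = (a \<oplus>\<^bsub>R\<^esub> d \<oplus>\<^bsub>R\<^esub> k) \<oplus>\<^bsub>R\<^esub> (f \<oplus>\<^bsub>R\<^esub> l)"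
      using m by (simp add: a_ac)
    also have "\<dots> = (c \<oplus>\<^bsub>R\<^esub> f \<oplus>\<^bsub>R\<^esub> l) \<oplus>\<^bsub>R\<^esub> (b \<oplus>\<^bsub>R\<^esub> k)"
      unfolding k using m by (simp add: a_ac)
    also have "\<dots> = e \<oplus>\<^bsub>R\<^esub> b \<oplus>\<^bsub>R\<^esub> (d \<oplus>\<^bsub>R\<^esub> k \<oplus>\<^bsub>R\<^esub> l)"
      unfolding l using m by (simp add: a_ac)
    finally have "\<exists>k \<in> carrier R. a \<oplus>\<^bsub>R\<^esub> f \<oplus>\<^bsub>R\<^esub> k = e \<oplus>\<^bsub>R\<^esub> b \<oplus>\<^bsub>R\<^esub> k"
      using m by blast
    then show "(x, z) \<in> groth_rel R"
      using m by (simp add: groth_rel_def xyz)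
  qed
qed

lemma mark_eq:
  assumes "group G" "U \<subseteq> carrier G" "X \<in> carrier (gset_semiring G)" "Y \<in> carrier (gset_semiring G)"
  shows "(\<lambda>(X, Y). int (class_mark U X) - int (class_mark U Y)) `
      (groth_rel (gset_semiring G) `` {(X, Y)}) = {int (class_mark U X) - int (class_mark U Y)}"
    and "mark U (groth_rel (gset_semiring G) `` {(X, Y)}) =
      int (class_mark U X) - int (class_mark U Y)"
proof -
  let ?R = "gset_semiring G"
  let ?m = "\<lambda>(X, Y). int (class_mark U X) - int (class_mark U Y)"
  interpret abelian_monoid ?R by (rule gset_semiring_abelian_monoid) fact
  note add = class_mark_add[OF assms(1,2)]
  have "?m (A, B) = ?m (X, Y)" if "(A, B) \<in> groth_rel ?R `` {(X, Y)}" for A B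
  proof -
    from that obtain K where K: "A \<in> carrier ?R" "B \<in> carrier ?R" "K \<in> carrier ?R"
      "X \<oplus>\<^bsub>?R\<^esub> B \<oplus>\<^bsub>?R\<^esub> K = A \<oplus>\<^bsub>?R\<^esub> Y \<oplus>\<^bsub>?R\<^esub> K"
      by (auto simp: groth_rel_def)
    then have "class_mark U (X \<oplus>\<^bsub>?R\<^esub> B \<oplus>\<^bsub>?R\<^esub> K) = class_mark U (A \<oplus>\<^bsub>?R\<^esub> Y \<oplus>\<^bsub>?R\<^esub> K)"
      by simp
    then show ?thesis
      using K(1-3) assms(3,4) by (simp add: add)
  qed
  moreover have "(X, Y) \<in> groth_rel ?R `` {(X, Y)}"
    using equiv_class_self[OF equiv_groth_rel[OF abelian_monoid_axioms]] assms by blast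
  ultimately have eq: "?m ` (groth_rel ?R `` {(X, Y)}) = {?m (X, Y)}"
    by fast
  then show "?m ` (groth_rel ?R `` {(X, Y)}) = {int (class_mark U X) - int (class_mark U Y)}"
    by simp
  show "mark U (groth_rel ?R `` {(X, Y)}) = int (class_mark U X) - int (class_mark U Y)"
    unfolding mark_def eq by simp
qed

lemma burnside_image_eq:
  assumes "group G"
  shows "burnside_image G =
    (\<lambda>(S, T). \<lambda>U \<in> subgroups_of G. int (card (fixed_points U S)) - int (card (fixed_points U T)))
      ` (gsets G \<times> gsets G)"
proof -
  let ?c = "\<lambda>S. gset_rel G `` {S}"
  have "ghost_map G (groth_rel (gset_semiring G) `` {(?c S, ?c T)}) =
      (\<lambda>U \<in> subgroups_of G. int (card (fixed_points U S)) - int (card (fixed_points U T)))"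
    if "S \<in> gsets G" "T \<in> gsets G" for S T
    unfolding ghost_map_def
  proof (rule restrict_ext)
    fix U assume "U \<in> subgroups_of G"
    then have "U \<subseteq> carrier G" by (auto simp: subgroups_of_def dest: subgroup.subset)
    then show "mark U (groth_rel (gset_semiring G) `` {(?c S, ?c T)}) =
        int (card (fixed_points U S)) - int (card (fixed_points U T))"
      using that by (simp add: mark_eq[OF assms] class_mark_eq carrier_gset_semiring)
  qed
  then have "(\<lambda>(S, T). ghost_map G (groth_rel (gset_semiring G) `` {(?c S, ?c T)}))
        ` (gsets G \<times> gsets G) =
      (\<lambda>(S, T). \<lambda>U \<in> subgroups_of G. int (card (fixed_points U S)) - int (card (fixed_points U T)))
        ` (gsets G \<times> gsets G)"
    by (intro image_cong refl) (simp only: mem_Times_iff case_prod_beta)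
  moreover have "carrier (burnside_ring G) =
      (\<lambda>(S, T). groth_rel (gset_semiring G) `` {(?c S, ?c T)}) ` (gsets G \<times> gsets G)"
    by (force simp: burnside_ring_def grothendieck_ring_def quotient_def carrier_gset_semiring)
  ultimately show ?thesis
    unfolding burnside_image_def by (simp add: image_image case_prod_beta')
qed

lemma conj_eq_image: "g <#\<^bsub>G\<^esub> U #>\<^bsub>G\<^esub> inv\<^bsub>G\<^esub> g = (\<lambda>u. g \<otimes>\<^bsub>G\<^esub> u \<otimes>\<^bsub>G\<^esub> inv\<^bsub>G\<^esub> g) ` U"
  by (auto simp: l_coset_def r_coset_def)

lemma fixed_points_conj:
  assumes "group G" "S \<in> gsets G" "U \<subseteq> carrier G" "g \<in> carrier G"
  shows "card (fixed_points (g <#\<^bsub>G\<^esub> U #>\<^bsub>G\<^esub> inv\<^bsub>G\<^esub> g) S) = card (fixed_points U S)"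
proof -
  interpret group G by fact
  obtain E \<phi> where S: "S = (E, \<phi>)" by (cases S)
  have cl: "\<phi> a x \<in> E" if "a \<in> carrier G" "x \<in> E" for a x
    using pre_action_gsets[OF assms(2)] that by (simp add: S pre_action_def)
  have one: "\<phi> \<one>\<^bsub>G\<^esub> x = x" if "x \<in> E" for x
    using pre_action_gsets[OF assms(2)] that by (simp add: S pre_action_def)
  have mult: "\<phi> a (\<phi> b x) = \<phi> (a \<otimes>\<^bsub>G\<^esub> b) x" if "a \<in> carrier G" "b \<in> carrier G" "x \<in> E" for a b x
    using pre_action_gsets[OF assms(2)] that by (simp add: S pre_action_def)
  have U: "u \<in> carrier G" if "u \<in> U" for u
    using assms(3) that by blast
  let ?i = "inv\<^bsub>G\<^esub> g"
  have "bij_betw (\<phi> g) (fixed_points U S) (fixed_points (g <#\<^bsub>G\<^esub> U #>\<^bsub>G\<^esub> ?i) S)"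
  proof (rule bij_betw_byWitness[where f' = "\<phi> ?i"])
    show "\<forall>x \<in> fixed_points U S. \<phi> ?i (\<phi> g x) = x"
      "\<forall>x \<in> fixed_points (g <#\<^bsub>G\<^esub> U #>\<^bsub>G\<^esub> ?i) S. \<phi> g (\<phi> ?i x) = x"
      using assms(4) by (auto simp: S fixed_points_def mult one)
    show "\<phi> g ` fixed_points U S \<subseteq> fixed_points (g <#\<^bsub>G\<^esub> U #>\<^bsub>G\<^esub> ?i) S"
    proof clarify
      fix x assume "x \<in> fixed_points U S"
      then have x: "x \<in> E" "\<And>u. u \<in> U \<Longrightarrow> \<phi> u x = x" by (auto simp: S fixed_points_def)
      have "\<phi> (g \<otimes>\<^bsub>G\<^esub> u \<otimes>\<^bsub>G\<^esub> ?i) (\<phi> g x) = \<phi> g x" if u: "u \<in> U" for u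
      proof -
        have "\<phi> (g \<otimes>\<^bsub>G\<^esub> u \<otimes>\<^bsub>G\<^esub> ?i) (\<phi> g x) = \<phi> (g \<otimes>\<^bsub>G\<^esub> u) x"
          using assms(4) U[OF u] x(1) by (simp add: mult m_assoc)
        also have "\<dots> = \<phi> g x"
          using assms(4) U[OF u] x u by (simp flip: mult)
        finally show ?thesis .
      qed
      then show "\<phi> g x \<in> fixed_points (g <#\<^bsub>G\<^esub> U #>\<^bsub>G\<^esub> ?i) S"
        using cl[OF assms(4) x(1)] by (auto simp: S fixed_points_def conj_eq_image)
    qed
    show "\<phi> ?i ` fixed_points (g <#\<^bsub>G\<^esub> U #>\<^bsub>G\<^esub> ?i) S \<subseteq> fixed_points U S"
    proof clarify
      fix x assume "x \<in> fixed_points (g <#\<^bsub>G\<^esub> U #>\<^bsub>G\<^esub> ?i) S"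
      then have x: "x \<in> E" "\<And>u. u \<in> U \<Longrightarrow> \<phi> (g \<otimes>\<^bsub>G\<^esub> u \<otimes>\<^bsub>G\<^esub> ?i) x = x"
        by (auto simp: S fixed_points_def conj_eq_image)
      have "\<phi> u (\<phi> ?i x) = \<phi> ?i x" if u: "u \<in> U" for u
      proof -
        have "?i \<otimes>\<^bsub>G\<^esub> (g \<otimes>\<^bsub>G\<^esub> u \<otimes>\<^bsub>G\<^esub> ?i) = u \<otimes>\<^bsub>G\<^esub> ?i"
          using assms(4) U[OF u] by (simp flip: m_assoc)
        then have "\<phi> u (\<phi> ?i x) = \<phi> ?i (\<phi> (g \<otimes>\<^bsub>G\<^esub> u \<otimes>\<^bsub>G\<^esub> ?i) x)"
          using assms(4) U[OF u] x(1) by (simp add: mult)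
        then show ?thesis using x(2)[OF u] by simp
      qed
      moreover have "\<phi> ?i x \<in> E" using cl assms(4) x(1) by simp
      ultimately show "\<phi> ?i x \<in> fixed_points U S"
        by (simp add: S fixed_points_def)
    qed
  qed
  then show ?thesis by (simp add: bij_betw_same_card)
qed

lemma burnside_image_subset_ghost_ring:
  assumes "group G"
  shows "burnside_image G \<subseteq> carrier (ghost_ring G)"
proof
  interpret group G by fact
  fix x assume "x \<in> burnside_image G"
  then obtain S T where m: "S \<in> gsets G" "T \<in> gsets G"
    and x: "x = (\<lambda>U \<in> subgroups_of G. int (card (fixed_points U S)) - int (card (fixed_points U T)))"
    by (auto simp: burnside_image_eq[OF assms])
  have "x (g <#\<^bsub>G\<^esub> U #>\<^bsub>G\<^esub> inv\<^bsub>G\<^esub> g) = x U" if "U \<in> subgroups_of G" "g \<in> carrier G" for U g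
  proof -
    have U: "subgroup U G" using that(1) by (simp add: subgroups_of_def)
    have "U \<subseteq> carrier G" "g <#\<^bsub>G\<^esub> U #>\<^bsub>G\<^esub> inv\<^bsub>G\<^esub> g \<in> subgroups_of G"
      using subgroup.subset[OF U] subgroup_conjugation_is_surj2[OF that(2) U]
      by (simp_all add: subgroups_of_def)
    then show ?thesis
      using that m by (simp add: x fixed_points_conj[OF assms])
  qed
  moreover have "x \<in> extensional (subgroups_of G)" by (simp add: x)
  ultimately show "x \<in> carrier (ghost_ring G)" by (simp add: ghost_ring_def)
qed

lemma cyclic_subgroups_conj:
  assumes "group G" "U \<in> subgroups_of G" "g \<in> carrier G"
  shows "g <#\<^bsub>G\<^esub> U #>\<^bsub>G\<^esub> inv\<^bsub>G\<^esub> g \<in> cyclic_subgroups G \<longleftrightarrow> U \<in> cyclic_subgroups G"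
proof -
  interpret group G by fact
  let ?V = "g <#\<^bsub>G\<^esub> U #>\<^bsub>G\<^esub> inv\<^bsub>G\<^esub> g"
  have U: "subgroup U G" using assms(2) by (simp add: subgroups_of_def)
  have V: "subgroup ?V G" by (rule subgroup_conjugation_is_surj2[OF assms(3) U])
  have c: "u \<in> carrier G" if "u \<in> U" for u using subgroup.mem_carrier[OF U that] .
  have "(\<lambda>u. g \<otimes>\<^bsub>G\<^esub> u \<otimes>\<^bsub>G\<^esub> inv\<^bsub>G\<^esub> g) \<in> iso (G\<lparr>carrier := U\<rparr>) (G\<lparr>carrier := ?V\<rparr>)"
  proof (rule isoI)
    have "g \<otimes>\<^bsub>G\<^esub> (u \<otimes>\<^bsub>G\<^esub> v) \<otimes>\<^bsub>G\<^esub> inv\<^bsub>G\<^esub> g =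
        g \<otimes>\<^bsub>G\<^esub> u \<otimes>\<^bsub>G\<^esub> inv\<^bsub>G\<^esub> g \<otimes>\<^bsub>G\<^esub> (g \<otimes>\<^bsub>G\<^esub> v \<otimes>\<^bsub>G\<^esub> inv\<^bsub>G\<^esub> g)" if "u \<in> U" "v \<in> U" for u v
    proof -
      have "inv\<^bsub>G\<^esub> g \<otimes>\<^bsub>G\<^esub> (g \<otimes>\<^bsub>G\<^esub> (v \<otimes>\<^bsub>G\<^esub> inv\<^bsub>G\<^esub> g)) = v \<otimes>\<^bsub>G\<^esub> inv\<^bsub>G\<^esub> g"
        using c[OF that(2)] assms(3) by (simp flip: m_assoc)
      then show ?thesis
        using c[OF that(1)] c[OF that(2)] assms(3) by (simp add: m_assoc)
    qed
    then show "(\<lambda>u. g \<otimes>\<^bsub>G\<^esub> u \<otimes>\<^bsub>G\<^esub> inv\<^bsub>G\<^esub> g) \<in> hom (G\<lparr>carrier := U\<rparr>) (G\<lparr>carrier := ?V\<rparr>)"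
      by (intro homI) (auto simp: conj_eq_image)
    show "bij_betw (\<lambda>u. g \<otimes>\<^bsub>G\<^esub> u \<otimes>\<^bsub>G\<^esub> inv\<^bsub>G\<^esub> g) (carrier (G\<lparr>carrier := U\<rparr>)) (carrier (G\<lparr>carrier := ?V\<rparr>))"
      using c assms(3) by (auto simp: bij_betw_def conj_eq_image intro!: inj_onI)
  qed
  then have "G\<lparr>carrier := U\<rparr> \<cong> G\<lparr>carrier := ?V\<rparr>" by (auto simp: is_iso_def)
  then have "cyclic_group (G\<lparr>carrier := U\<rparr>) \<longleftrightarrow> cyclic_group (G\<lparr>carrier := ?V\<rparr>)"
    using subgroup.subgroup_is_group[OF U assms(1)] subgroup.subgroup_is_group[OF V assms(1)]
    by (intro isomorphic_group_cyclicity)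
  then show ?thesis
    using U V by (simp add: cyclic_subgroups_def subgroups_of_def)
qed

lemma artin_element_ghost_ring:
  assumes "group G"
  shows "artin_element G (cyclic_subgroups G) n \<in> carrier (ghost_ring G)"
proof -
  interpret group G by fact
  have "g <#\<^bsub>G\<^esub> U #>\<^bsub>G\<^esub> inv\<^bsub>G\<^esub> g \<in> subgroups_of G" if "U \<in> subgroups_of G" "g \<in> carrier G" for U g
    using that subgroup_conjugation_is_surj2 by (simp add: subgroups_of_def)
  then show ?thesis
    by (simp add: ghost_ring_def artin_element_def cyclic_subgroups_conj[OF assms])
qed

end

(* An integral element of the Burnside ring takes congruent values modulo p at V and W whenever V is
   normal of prime index p in W. If the indicator function of the cyclic subgroups lies in the
   Burnside ring, then W is therefore cyclic as soon as V is. In a minimal noncyclic subgroup all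
   proper subgroups are cyclic, and by Miller and Moreno's counting of centralizers such a group has
   a normal subgroup of prime index: a contradiction. The Artin exponent exists because a G-set with f(U)
   fixed points, at most M and nonzero exactly for cyclic U, gives M! - (1 - f) ... (M - f), M! times the
   indicator function. *)

theory Submission
  imports Defs "HOL-Algebra.Sylow"
begin

section \<open>Groups with abelian proper subgroups\<close>

text \<open>The preimage in \<open>G\<close> of a subgroup of prime order \<open>p\<close> in the
  quotient by \<open>H\<close> is such a \<open>W\<close>. The prime exists because the quotient is
  nontrivial.\<close>

lemma (in normal) prime_index_overgroup:
  assumes "finite (carrier G)" "H \<noteq> carrier G"
  obtains p W where "prime p" "subgroup W G" "H \<subseteq> W" "card W = p * card H"
proof -
  interpret Q: group "G Mod H" by (rule factorgroup_is_group)
  have fin: "finite (carrier (G Mod H))"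
    using assms(1) by (simp add: carrier_FactGroup)
  have "carrier (G Mod H) \<noteq> {\<one>\<^bsub>G Mod H\<^esub>}"
    using fact_group_trivial_iff[OF assms(1)] assms(2) by simp
  then have "order (G Mod H) \<noteq> 1"
    using Q.order_one_triv_iff by blast
  then obtain p where p: "prime p" "p dvd order (G Mod H)"
    using prime_factor_nat by blast
  \<comment> \<open>With exponent 1, Sylow's theorem becomes Cauchy's theorem.\<close>
  then obtain m where "order (G Mod H) = p ^ 1 * m" by auto
  from sylow_thm[OF p(1) Q.group_axioms this fin]
  obtain A where A: "subgroup A (G Mod H)" "card A = p" by auto
  note W = factgroup_subgroup_union_subgroup[OF A(1)]
  have sub: "H \<subseteq> \<Union>A"
    using subgroup.one_closed[OF A(1)] by auto
  interpret W: group "G\<lparr>carrier := \<Union>A\<rparr>"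
    using subgroup.subgroup_is_group[OF W is_group] .
  have "subgroup H (G\<lparr>carrier := \<Union>A\<rparr>)"
    using subgroup_incl[OF is_subgroup W sub] .
  then have "card (\<Union>A) = p * card H"
    using W.lagrange[of H] A(2) factgroup_subgroup_union_factor[OF A(1)] by (simp add: order_def)
  then show thesis using that p(1) W sub by blast
qed

section \<open>Centralizers, the center and conjugation\<close>

definition centralizer :: "('a, 'm) monoid_scheme \<Rightarrow> 'a \<Rightarrow> 'a set" where
  "centralizer G g = {x \<in> carrier G. x \<otimes>\<^bsub>G\<^esub> g = g \<otimes>\<^bsub>G\<^esub> x}"

definition center :: "('a, 'm) monoid_scheme \<Rightarrow> 'a set" where
  "center G = {z \<in> carrier G. \<forall>x \<in> carrier G. x \<otimes>\<^bsub>G\<^esub> z = z \<otimes>\<^bsub>G\<^esub> x}"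

definition conjugate :: "('a, 'm) monoid_scheme \<Rightarrow> 'a \<Rightarrow> 'a \<Rightarrow> 'a" where
  "conjugate G x m = x \<otimes>\<^bsub>G\<^esub> m \<otimes>\<^bsub>G\<^esub> inv\<^bsub>G\<^esub> x"

context group
begin

lemma conj_closed [simp]: "x \<in> carrier G \<Longrightarrow> m \<in> carrier G \<Longrightarrow> conjugate G x m \<in> carrier G"
  by (simp add: conjugate_def)

lemma conj_conj:
  assumes "x \<in> carrier G" "y \<in> carrier G" "m \<in> carrier G"
  shows "conjugate G x (conjugate G y m) = conjugate G (x \<otimes> y) m"
  using assms by (simp add: conjugate_def m_assoc inv_mult_group)

lemma conj_one [simp]: "m \<in> carrier G \<Longrightarrow> conjugate G \<one> m = m"
  by (simp add: conjugate_def)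

text \<open>Conjugating back by \<open>y\<close> leaves a single conjugator; coincidences between
  conjugates of different elements are analysed in this form.\<close>

lemma conj_eq_iff:
  assumes "x \<in> carrier G" "y \<in> carrier G" "m \<in> carrier G" "n \<in> carrier G"
  shows "conjugate G x m = conjugate G y n \<longleftrightarrow> conjugate G (inv y \<otimes> x) m = n"
proof
  assume "conjugate G x m = conjugate G y n"
  then have "conjugate G (inv y) (conjugate G x m) = conjugate G (inv y) (conjugate G y n)" by simp
  then show "conjugate G (inv y \<otimes> x) m = n" using assms by (simp add: conj_conj)
next
  assume "conjugate G (inv y \<otimes> x) m = n"
  then have "conjugate G y n = conjugate G y (conjugate G (inv y \<otimes> x) m)" by simp
  also have "\<dots> = conjugate G x m" using assms by (simp add: conj_conj flip: m_assoc)
  finally show "conjugate G x m = conjugate G y n" by simp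
qed

lemma conj_mult:
  assumes "x \<in> carrier G" "m \<in> carrier G" "n \<in> carrier G"
  shows "conjugate G x (m \<otimes> n) = conjugate G x m \<otimes> conjugate G x n"
proof -
  have "inv x \<otimes> (x \<otimes> (n \<otimes> inv x)) = n \<otimes> inv x"
    using assms by (simp flip: m_assoc)
  then show ?thesis using assms by (simp add: conjugate_def m_assoc)
qed

lemma conj_inj:
  assumes "x \<in> carrier G" "m \<in> carrier G" "n \<in> carrier G"
  shows "conjugate G x m = conjugate G x n \<longleftrightarrow> m = n"
  using assms by (simp add: conj_eq_iff)

text \<open>Conjugation is an injective homomorphism, so it preserves and reflects
  commuting.\<close>

lemma conj_commutes:
  assumes "x \<in> carrier G" "m \<in> carrier G" "n \<in> carrier G"
  shows "conjugate G x m \<in> centralizer G (conjugate G x n) \<longleftrightarrow> m \<in> centralizer G n"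
  using assms by (simp add: centralizer_def conj_inj flip: conj_mult)

lemma conj_commuting:
  assumes "x \<in> carrier G" "m \<in> carrier G" "x \<otimes> m = m \<otimes> x"
  shows "conjugate G x m = m"
  using assms by (simp add: conjugate_def m_assoc)

lemma conj_center_iff:
  assumes "x \<in> carrier G" "m \<in> carrier G"
  shows "conjugate G x m \<in> center G \<longleftrightarrow> m \<in> center G"
proof -
  have *: "conjugate G y n \<in> center G" if "n \<in> center G" "y \<in> carrier G" for y n
    using that conj_commuting[of y n] by (auto simp: center_def)
  show ?thesis
    using *[of "conjugate G x m" "inv x"] *[of m x] assms by (auto simp: conj_conj)
qed

lemma subgroup_centralizer:
  assumes "g \<in> carrier G"
  shows "subgroup (centralizer G g) G"
proof (rule subgroupI)
  show "centralizer G g \<subseteq> carrier G" by (auto simp: centralizer_def)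
  show "centralizer G g \<noteq> {}" using assms by (auto simp: centralizer_def)
  fix a assume a: "a \<in> centralizer G g"
  then have a': "a \<in> carrier G" "a \<otimes> g = g \<otimes> a" by (auto simp: centralizer_def)
  have "inv a \<otimes> g = inv a \<otimes> (g \<otimes> a) \<otimes> inv a" using a'(1) assms by (simp add: m_assoc)
  also have "\<dots> = g \<otimes> inv a" using a'(1) assms by (simp flip: a'(2) m_assoc)
  finally show "inv a \<in> centralizer G g"
    using a'(1) by (simp add: centralizer_def)
  fix b assume b: "b \<in> centralizer G g"
  then have b': "b \<in> carrier G" "b \<otimes> g = g \<otimes> b" by (auto simp: centralizer_def)
  have "a \<otimes> b \<otimes> g = a \<otimes> g \<otimes> b" using a'(1) b' assms by (simp add: m_assoc)
  also have "\<dots> = g \<otimes> (a \<otimes> b)" using a' b'(1) assms by (simp add: m_assoc)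
  finally show "a \<otimes> b \<in> centralizer G g" using a b by (simp add: centralizer_def)
qed

text \<open>The overgroup of prime index over \<open>N\<close> is strictly larger than
  \<open>N\<close>, so maximality forces it to be the whole group.\<close>

lemma normalI_maximal_prime_index:
  assumes "finite (carrier G)" "N \<lhd> G" "N \<noteq> carrier G"
    and "\<And>W. subgroup W G \<Longrightarrow> N \<subset> W \<Longrightarrow> W = carrier G"
  shows "\<exists>p. prime p \<and> order G = p * card N"
proof -
  obtain p W where W: "prime p" "subgroup W G" "N \<subseteq> W" "card W = p * card N"
    using normal.prime_index_overgroup[OF assms(2,1,3)] by blast
  have "card N > 0"
    using assms(1,2) by (metis card_gt_0_iff empty_iff finite_subset normal_imp_subgroup
        subgroup.one_closed subgroup.subset)
  then have "N \<noteq> W" using W(1,4) by auto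
  then have "W = carrier G" using assms(4) W by blast
  then show ?thesis using W by (auto simp: order_def)
qed

text \<open>Every subgroup of an abelian group is normal, so any maximal proper subgroup serves as
  \<open>N\<close>.\<close>

lemma ex_normal_prime_index_comm:
  assumes "finite (carrier G)" "order G \<noteq> 1"
    and "\<And>x y. x \<in> carrier G \<Longrightarrow> y \<in> carrier G \<Longrightarrow> x \<otimes> y = y \<otimes> x"
  shows "\<exists>N p. N \<lhd> G \<and> prime p \<and> order G = p * card N"
proof -
  interpret comm_group G
    using assms(3) by unfold_locales auto
  let ?P = "{H. subgroup H G \<and> H \<noteq> carrier G}"
  have "finite ?P"
    by (rule finite_subset[of _ "Pow (carrier G)"]) (use assms(1) in \<open>auto dest: subgroup.subset\<close>)
  \<comment> \<open>Nontriviality of the group makes the family of proper subgroups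
    nonempty.\<close>
  moreover have "{\<one>} \<in> ?P"
    using triv_subgroup assms(2) by (auto simp: order_def) (metis card.empty card_insert_disjoint
        empty_iff finite.emptyI One_nat_def)
  ultimately obtain N where N: "N \<in> ?P" "\<And>W. W \<in> ?P \<Longrightarrow> N \<subseteq> W \<Longrightarrow> N = W"
    using finite_has_maximal[of ?P] by blast
  have "N \<lhd> G" using N(1) subgroup_imp_normal by blast
  moreover have "\<exists>p. prime p \<and> order G = p * card N"
    using N by (intro normalI_maximal_prime_index[OF assms(1) \<open>N \<lhd> G\<close>]) auto
  ultimately show ?thesis by blast
qed

end

section \<open>Counting conjugates of centralizers\<close>

text \<open>Miller and Moreno: in a nonabelian group as below, commuting is an equivalence relation on the noncentral elements, whose
  classes are the sets \<open>C(g) - Z\<close>. The centralizers \<open>C(g)\<close> are self-normalizing, so the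
  conjugates of \<open>C(g) - Z\<close> cover exactly \<open>|G| - |G||Z|/|C(g)| \<ge> |G|/2\<close> noncentral elements.
  One conjugacy class of centralizers therefore covers too few elements, and two cover too many.\<close>

locale prime_index_counterexample = group +
  assumes fin: "finite (carrier G)"
    and proper_comm: "\<And>H x y. subgroup H G \<Longrightarrow> H \<noteq> carrier G \<Longrightarrow> x \<in> H \<Longrightarrow> y \<in> H \<Longrightarrow> x \<otimes> y = y \<otimes> x"
    and no_prime_index: "\<And>N p. N \<lhd> G \<Longrightarrow> prime p \<Longrightarrow> order G \<noteq> p * card N"
begin

abbreviation "C \<equiv> centralizer G"
abbreviation "Z \<equiv> center G"

lemma centralizer_proper: "g \<in> carrier G - Z \<Longrightarrow> C g \<noteq> carrier G"
  by (auto simp: centralizer_def center_def)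

text \<open>Since \<open>g\<close> and \<open>m\<close> are noncentral, both centralizers are
  proper, hence abelian, and each contains both elements. So whatever commutes with one commutes
  with the other.\<close>

lemma centralizer_eq:
  assumes "g \<in> carrier G - Z" "m \<in> C g - Z"
  shows "C m = C g"
proof
  have m: "m \<in> carrier G" "g \<in> C m" "g \<in> C g" using assms by (auto simp: centralizer_def)
  have g: "g \<in> carrier G" "m \<in> carrier G - Z" using assms m by auto
  note comm = proper_comm[OF subgroup_centralizer centralizer_proper]
  have mg: "m \<in> C g" using assms by simp
  show "C g \<subseteq> C m"
  proof
    fix x assume "x \<in> C g"
    then show "x \<in> C m" using comm[OF g(1) assms(1) _ mg, of x] by (simp add: centralizer_def)
  qed
  show "C m \<subseteq> C g"
  proof
    fix x assume "x \<in> C m"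
    then show "x \<in> C g" using comm[OF m(1) g(2) _ m(2), of x] by (simp add: centralizer_def)
  qed
qed

text \<open>A proper \<open>W\<close> is abelian, so all of it commutes with its element
  \<open>g\<close>. In particular the centralizers of noncentral elements are maximal
  subgroups.\<close>

lemma centralizer_maximal:
  assumes "g \<in> carrier G - Z" "subgroup W G" "g \<in> W" "W \<noteq> carrier G"
  shows "W \<subseteq> C g"
  using proper_comm[OF assms(2,4) _ assms(3)] subgroup.subset[OF assms(2)]
  by (auto simp: centralizer_def)

text \<open>The normalizer of \<open>C g\<close> contains \<open>g\<close>. If it were the whole
  group, \<open>C g\<close> would be normal and maximal, hence of prime index, which is excluded. So
  it is proper and lies in \<open>C g\<close> by maximality.\<close>

lemma self_normalizing:
  assumes g: "g \<in> carrier G - Z" and z: "z \<in> carrier G"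
    and norm: "\<And>n. n \<in> carrier G \<Longrightarrow> conjugate G z n \<in> C g \<longleftrightarrow> n \<in> C g"
  shows "z \<in> C g"
proof -
  \<comment> \<open>The normalizer of \<open>C g\<close>; stating it with an equivalence makes
    closure under inverses immediate.\<close>
  let ?N = "{x \<in> carrier G. \<forall>n \<in> carrier G. conjugate G x n \<in> C g \<longleftrightarrow> n \<in> C g}"
  have g': "g \<in> carrier G" "g \<in> C g" using g by (auto simp: centralizer_def)
  note sub = subgroup_centralizer[OF g'(1)]
  have N: "subgroup ?N G"
  proof (rule subgroupI)
    fix a assume a: "a \<in> ?N"
    have "conjugate G (inv a) n \<in> C g \<longleftrightarrow> n \<in> C g" if "n \<in> carrier G" for n
    proof -
      have "conjugate G (inv a) n \<in> C g \<longleftrightarrow> conjugate G a (conjugate G (inv a) n) \<in> C g"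
        using a that by simp
      then show ?thesis using a that by (simp add: conj_conj)
    qed
    then show "inv a \<in> ?N" using a by simp
    fix b assume b: "b \<in> ?N"
    then show "a \<otimes> b \<in> ?N" using a by (simp flip: conj_conj)
  next
    show "?N \<noteq> {}" by (auto intro!: exI[of _ \<one>])
  qed auto
  have "?N \<noteq> carrier G"
  proof
    assume eq: "?N = carrier G"
    have "C g \<lhd> G"
      using eq subgroup.subset[OF sub] by (intro normal_invI[OF sub]) (auto simp: conjugate_def)
    moreover have "\<exists>p. prime p \<and> order G = p * card (C g)"
      using centralizer_maximal[OF g] g'
      by (intro normalI_maximal_prime_index[OF fin \<open>C g \<lhd> G\<close> centralizer_proper[OF g]]) auto
    ultimately show False using no_prime_index by blast
  qed
  moreover have "g \<in> ?N"
  proof -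
    have "conjugate G g n \<in> C g \<longleftrightarrow> n \<in> C g" if "n \<in> carrier G" for n
      using conj_commutes[OF g'(1) that g'(1)] conj_commuting[OF g'(1,1)] by simp
    then show ?thesis using g' by blast
  qed
  ultimately have "?N \<subseteq> C g" using centralizer_maximal[OF g N] by blast
  then show ?thesis using z norm by blast
qed

text \<open>The union of the conjugates of \<open>C g - Z\<close>, written as an image of pairs so
  that its size follows from counting fibres.\<close>

definition "cover g = (\<lambda>(x, m). conjugate G x m) ` (carrier G \<times> (C g - Z))"

text \<open>Both \<open>m\<close> and its conjugate have centralizer \<open>C g\<close>, and
  conjugation by \<open>z\<close> carries the first centralizer to the second. So \<open>z\<close>
  normalizes \<open>C g\<close>.\<close>

lemma conj_within_centralizer:
  assumes g: "g \<in> carrier G - Z" and z: "z \<in> carrier G"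
    and m: "m \<in> C g - Z" "conjugate G z m \<in> C g - Z"
  shows "z \<in> C g"
proof (rule self_normalizing[OF g z])
  fix n assume n: "n \<in> carrier G"
  have c: "m \<in> carrier G" using m(1) by (simp add: centralizer_def)
  show "conjugate G z n \<in> C g \<longleftrightarrow> n \<in> C g"
    using conj_commutes[OF z n c] unfolding centralizer_eq[OF g m(1)] centralizer_eq[OF g m(2)] .
qed

text \<open>Double counting of pairs: the fibre through \<open>(y, m)\<close> consists of the pairs
  \<open>(y \<otimes> c, m)\<close> with \<open>c\<close> in \<open>C g\<close>, so every fibre has
  \<open>card (C g)\<close> elements.\<close>

lemma card_cover:
  assumes g: "g \<in> carrier G - Z"
  shows "card (cover g) * card (C g) = order G * card (C g - Z)"
proof -
  let ?A = "carrier G \<times> (C g - Z)" and ?f = "\<lambda>(x, m). conjugate G x m"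
  have cs: "C g \<subseteq> carrier G" by (auto simp: centralizer_def)
  have finA: "finite ?A" using fin cs finite_subset by blast
  have fib: "card {a \<in> ?A. ?f a = b} = card (C g)" if b: "b \<in> cover g" for b
  proof -
    obtain y m where y: "y \<in> carrier G" "m \<in> C g - Z" "b = conjugate G y m"
      using b by (auto simp: cover_def)
    have m: "m \<in> carrier G" using y cs by blast
    have fixm: "conjugate G c m = m" if "c \<in> C g" for c
      using that y m unfolding centralizer_eq[OF g y(2), symmetric]
      by (intro conj_commuting) (auto simp: centralizer_def)
    have "{a \<in> ?A. ?f a = b} = (\<lambda>c. (y \<otimes> c, m)) ` C g"
    proof (intro subset_antisym subsetI)
      fix a assume "a \<in> {a \<in> ?A. ?f a = b}"
      then obtain x n where a: "a = (x, n)" "x \<in> carrier G" "n \<in> C g - Z" "conjugate G x n = conjugate G y m"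
        using y(3) by auto
      have eq: "conjugate G (inv y \<otimes> x) n = m"
        using a y m cs by (subst conj_eq_iff[symmetric]) auto
      \<comment> \<open>This element conjugates \<open>n\<close> to \<open>m\<close>, both in
        \<open>C g - Z\<close>. Once in \<open>C g\<close>, it commutes with \<open>n\<close>, which
        forces \<open>n = m\<close>.\<close>
      have c: "inv y \<otimes> x \<in> C g"
        using a y eq by (intro conj_within_centralizer[OF g, of _ n]) auto
      have "conjugate G (inv y \<otimes> x) n = n"
        using c a cs unfolding centralizer_eq[OF g a(3), symmetric]
        by (intro conj_commuting) (auto simp: centralizer_def)
      then have "a = (y \<otimes> (inv y \<otimes> x), m)" using a y eq by (simp flip: m_assoc)
      then show "a \<in> (\<lambda>c. (y \<otimes> c, m)) ` C g" using c by blast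
    next
      fix a assume "a \<in> (\<lambda>c. (y \<otimes> c, m)) ` C g"
      then show "a \<in> {a \<in> ?A. ?f a = b}"
        using y m cs fixm by (auto simp flip: conj_conj)
    qed
    moreover have "inj_on (\<lambda>c. (y \<otimes> c, m)) (C g)"
      using y cs by (intro inj_onI) (auto simp: subset_iff)
    ultimately show ?thesis by (simp add: card_image)
  qed
  have "order G * card (C g - Z) = card ?A" by (simp add: order_def card_cartesian_product)
  also have "\<dots> = (\<Sum>b \<in> ?f ` ?A. card {a \<in> ?A. ?f a = b})"
    using sum.image_gen[OF finA, of "\<lambda>_. 1::nat" ?f] by simp
  also have "\<dots> = card (cover g) * card (C g)"
    using fib by (simp add: cover_def)
  finally show ?thesis by simp
qed

lemma cover_subset: "cover g \<subseteq> carrier G - Z"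
  by (auto simp: cover_def centralizer_def conj_center_iff)

text \<open>At a common point, conjugation by \<open>w\<close> takes \<open>n\<close> to
  \<open>m\<close>. It then takes \<open>h\<close>, which commutes with \<open>n\<close>, into
  \<open>C m = C g\<close>, so \<open>h\<close> itself would lie in \<open>cover g\<close>.\<close>

lemma cover_disjoint:
  assumes g: "g \<in> carrier G - Z" "h \<in> carrier G - Z" "h \<notin> cover g"
  shows "cover g \<inter> cover h = {}"
proof (rule ccontr)
  assume "cover g \<inter> cover h \<noteq> {}"
  then obtain x y m n where *: "x \<in> carrier G" "y \<in> carrier G" "m \<in> C g - Z" "n \<in> C h - Z"
    "conjugate G y n = conjugate G x m"
    by (fastforce simp: cover_def)
  have c: "m \<in> carrier G" "n \<in> carrier G" "h \<in> C n" using * g by (auto simp: centralizer_def)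
  define w where "w = inv x \<otimes> y"
  have w: "w \<in> carrier G" "conjugate G w n = m"
    using * c by (simp_all add: w_def conj_eq_iff)
  have "conjugate G w h \<in> C (conjugate G w n)"
    using c(3) g conj_commutes[OF w(1) _ c(2), of h] by simp
  then have "conjugate G w h \<in> C g" unfolding w(2) centralizer_eq[OF g(1) *(3)] .
  then have "conjugate G w h \<in> C g - Z"
    using w(1) g(2) by (simp add: conj_center_iff)
  then have "conjugate G (inv w) (conjugate G w h) \<in> cover g"
    using w by (force simp: cover_def)
  then show False using g w by (simp add: conj_conj)
qed

lemma comm: "x \<in> carrier G \<Longrightarrow> y \<in> carrier G \<Longrightarrow> x \<otimes> y = y \<otimes> x"
proof -
  have "Z = carrier G"
  proof (rule ccontr)
    assume "Z \<noteq> carrier G"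
    then obtain g where g: "g \<in> carrier G - Z" by (auto simp: center_def)
    have finZ: "finite Z" using fin by (auto simp: center_def)
    have finC: "finite (C g)" for g using fin by (auto simp: centralizer_def)
    have ZC: "Z \<subseteq> C g" if "g \<in> carrier G" for g
      using that by (auto simp: centralizer_def center_def)
    have one: "\<one> \<in> Z" by (simp add: center_def)
    then have Zpos: "card Z > 0" using finZ card_gt_0_iff by blast
    have half: "order G \<le> 2 * card (cover g)" if g: "g \<in> carrier G - Z" for g
    proof -
      \<comment> \<open>Translation by \<open>g\<close> embeds \<open>Z\<close> into
        \<open>C g - Z\<close>, so the latter makes up at least half of \<open>C g\<close>.\<close>
      have gZ: "(\<lambda>z. g \<otimes> z) ` Z \<subseteq> C g - Z"
      proof clarify
        fix z assume z: "z \<in> Z"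
        then have z': "z \<in> carrier G" by (simp add: center_def)
        have "z \<otimes> g = g \<otimes> z" using z g by (auto simp: center_def)
        then have "g \<otimes> z \<in> C g" using g z' by (simp add: centralizer_def m_assoc)
        moreover have "g \<otimes> z \<notin> Z"
        proof
          assume gz: "g \<otimes> z \<in> Z"
          have "x \<otimes> g = g \<otimes> x" if x: "x \<in> carrier G" for x
          proof -
            have "x \<otimes> g \<otimes> z = g \<otimes> z \<otimes> x" using gz x g z' by (simp add: center_def m_assoc)
            also have "\<dots> = g \<otimes> x \<otimes> z" using z x g z' by (simp add: center_def m_assoc)
            finally show ?thesis using x g z' by simp
          qed
          then show False using g by (simp add: center_def)
        qed
        ultimately show "g \<otimes> z \<in> C g - Z" by blast
      qed
      have "inj_on (\<lambda>z. g \<otimes> z) Z"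
        using g by (intro inj_onI) (auto simp: center_def)
      then have "card Z \<le> card (C g - Z)"
        using card_mono[OF _ gZ] finC by (simp add: card_image)
      moreover have "card (C g) = card (C g - Z) + card Z"
        using ZC[of g] g finC finZ card_mono[OF finC, of Z g] by (simp add: card_Diff_subset)
      ultimately have "card (C g) \<le> 2 * card (C g - Z)" by simp
      then have "order G * card (C g) \<le> order G * (2 * card (C g - Z))" by (rule mult_le_mono2)
      also have "\<dots> = 2 * card (cover g) * card (C g)" using card_cover[OF g] by simp
      finally show ?thesis using ZC[of g] g one finC[of g] by (auto simp: card_gt_0_iff)
    qed
    have cG: "card (carrier G - Z) + card Z = order G"
      using fin finZ card_mono[OF fin, of Z]
      by (simp add: card_Diff_subset order_def center_def)
    \<comment> \<open>If one class of centralizers covered every noncentral element, the exact count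
      would give \<open>C g\<close> the order of the group.\<close>
    have "cover g \<noteq> carrier G - Z"
    proof
      assume eq: "cover g = carrier G - Z"
      have "card (C g - Z) + card Z = card (C g)"
        using ZC[of g] g finC finZ card_mono[OF finC, of Z g] by (simp add: card_Diff_subset)
      then have "order G * card (C g - Z) + order G * card Z = order G * card (C g)"
        by (metis add_mult_distrib2)
      also have "\<dots> = card (carrier G - Z) * card (C g) + card Z * card (C g)"
        by (metis cG add_mult_distrib)
      finally have "order G * card Z = card Z * card (C g)"
        using card_cover[OF g] eq by simp
      then have "card (C g) = card (carrier G)" using Zpos by (simp add: order_def)
      moreover have "C g \<subseteq> carrier G" by (auto simp: centralizer_def)
      ultimately show False
        using card_subset_eq[OF fin] centralizer_proper[OF g] by blast
    qed
    then obtain h where h: "h \<in> carrier G - Z" "h \<notin> cover g"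
      using cover_subset by blast
    have f: "finite (cover k)" for k using cover_subset fin finite_subset by (metis finite_Diff)
    \<comment> \<open>Two disjoint covers together have at least \<open>order G\<close> elements,
      more than there are noncentral ones.\<close>
    have "card (cover g) + card (cover h) = card (cover g \<union> cover h)"
      using cover_disjoint[OF g h] f by (simp add: card_Un_disjoint)
    also have "\<dots> \<le> card (carrier G - Z)"
      using cover_subset fin by (intro card_mono) auto
    finally show False using half[OF g] half[OF h(1)] cG Zpos by simp
  qed
  then show "x \<otimes> y = y \<otimes> x" if "x \<in> carrier G" "y \<in> carrier G"
    using that by (auto simp: center_def)
qed

end

text \<open>A counterexample would be abelian by the count above, and nontrivial abelian groups have
  a subgroup of prime index.\<close>

lemma (in group) ex_normal_prime_index:
  assumes "finite (carrier G)" "order G \<noteq> 1"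
    and "\<And>H x y. subgroup H G \<Longrightarrow> H \<noteq> carrier G \<Longrightarrow> x \<in> H \<Longrightarrow> y \<in> H \<Longrightarrow> x \<otimes> y = y \<otimes> x"
  shows "\<exists>N p. N \<lhd> G \<and> prime p \<and> order G = p * card N"
proof (rule ccontr)
  assume *: "\<not> ?thesis"
  interpret prime_index_counterexample G
    using assms * by unfold_locales blast+
  show False using * ex_normal_prime_index_comm[OF assms(1,2) comm] by blast
qed

section \<open>The Burnside ring as a ring of functions\<close>

lemma fixed_points_prod:
  assumes "group G" "U \<subseteq> carrier G" "S \<in> gsets G" "T \<in> gsets G"
  shows "card (fixed_points U (gset_prod S T)) = card (fixed_points U S) * card (fixed_points U T)"
proof -
  have "card (fixed_points U (gset_prod S T)) = card (fixed_points U (cprod S T))"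
    using fixed_points_iso[OF assms(2) gset_sum_prod(4)[OF assms(1,3,4)]]
      dsum_cprod_action(2)[OF assms(3,4)[THEN pre_action_gsets]] by simp
  also have "fixed_points U (cprod S T) = fixed_points U S \<times> fixed_points U T"
    by (auto simp: fixed_points_def cprod_def split: prod.splits)
  finally show ?thesis by (simp add: card_cartesian_product)
qed

text \<open>Membership in the Burnside ring for functions with arbitrary values off the subgroups,
  so that ring operations can be written pointwise.\<close>

definition virtual_mark :: "('a, 'm) monoid_scheme \<Rightarrow> ('a set \<Rightarrow> int) \<Rightarrow> bool" where
  "virtual_mark G f \<longleftrightarrow> restrict f (subgroups_of G) \<in> burnside_image G"

lemma virtual_mark_iff:
  assumes "group G"
  shows "virtual_mark G f \<longleftrightarrow> (\<exists>S \<in> gsets G. \<exists>T \<in> gsets G. \<forall>U \<in> subgroups_of G.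
    f U = int (card (fixed_points U S)) - int (card (fixed_points U T)))"
proof -
  have "restrict f A = restrict g A \<longleftrightarrow> (\<forall>U \<in> A. f U = g U)" for A and g :: "'a set \<Rightarrow> int"
    by (auto simp: restrict_def fun_eq_iff)
  then show ?thesis
    unfolding virtual_mark_def burnside_image_eq[OF assms] image_iff Bex_def mem_Times_iff
    by (simp add: split_paired_Ex)
qed

lemma subgroups_of_subset: "U \<in> subgroups_of G \<Longrightarrow> U \<subseteq> carrier G"
  by (auto simp: subgroups_of_def dest: subgroup.subset)

lemma fixed_points_zero: "fixed_points U gset_zero = {}"
  by (simp add: fixed_points_def gset_zero_def)

lemma virtual_mark_card:
  assumes "group G" "S \<in> gsets G"
  shows "virtual_mark G (\<lambda>U. int (card (fixed_points U S)))"
  unfolding virtual_mark_iff[OF assms(1)]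
  by (rule bexI[OF bexI[OF _ gset_zero[OF assms(1)]] assms(2)]) (simp add: fixed_points_zero)

lemma virtual_mark_one:
  assumes "group G"
  shows "virtual_mark G (\<lambda>U. 1)"
proof -
  have "fixed_points U gset_one = {0}" for U :: "'a set"
    by (auto simp: fixed_points_def gset_one_def)
  then show ?thesis using virtual_mark_card[OF assms gset_one[OF assms]] by simp
qed

lemma virtual_mark_diff:
  assumes "group G" "virtual_mark G f" "virtual_mark G g"
  shows "virtual_mark G (\<lambda>U. f U - g U)"
proof -
  obtain S T where f: "S \<in> gsets G" "T \<in> gsets G" "\<And>U. U \<in> subgroups_of G \<Longrightarrow>
      f U = int (card (fixed_points U S)) - int (card (fixed_points U T))"
    using assms(2) unfolding virtual_mark_iff[OF assms(1)] by blast
  obtain S' T' where g: "S' \<in> gsets G" "T' \<in> gsets G" "\<And>U. U \<in> subgroups_of G \<Longrightarrow>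
      g U = int (card (fixed_points U S')) - int (card (fixed_points U T'))"
    using assms(3) unfolding virtual_mark_iff[OF assms(1)] by blast
  note sum = gset_sum_prod(1)[OF assms(1)]
  show ?thesis
    unfolding virtual_mark_iff[OF assms(1)]
    \<comment> \<open>The difference is represented by the formal difference of
      \<open>S + T'\<close> and \<open>T + S'\<close>.\<close>
    by (rule bexI[OF bexI[OF ballI sum[OF f(2) g(1)]] sum[OF f(1) g(2)]])
       (simp add: f g fixed_points_sum[OF assms(1)] subgroups_of_subset)
qed

lemma virtual_mark_mult:
  assumes "group G" "virtual_mark G f" "virtual_mark G g"
  shows "virtual_mark G (\<lambda>U. f U * g U)"
proof -
  obtain S T where f: "S \<in> gsets G" "T \<in> gsets G" "\<And>U. U \<in> subgroups_of G \<Longrightarrow>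
      f U = int (card (fixed_points U S)) - int (card (fixed_points U T))"
    using assms(2) unfolding virtual_mark_iff[OF assms(1)] by blast
  obtain S' T' where g: "S' \<in> gsets G" "T' \<in> gsets G" "\<And>U. U \<in> subgroups_of G \<Longrightarrow>
      g U = int (card (fixed_points U S')) - int (card (fixed_points U T'))"
    using assms(3) unfolding virtual_mark_iff[OF assms(1)] by blast
  note sum = gset_sum_prod(1)[OF assms(1)] and prod = gset_sum_prod(3)[OF assms(1)]
  show ?thesis
    unfolding virtual_mark_iff[OF assms(1)]
    \<comment> \<open>The product is represented by the formal difference of
      \<open>S S' + T T'\<close> and \<open>S T' + T S'\<close>.\<close>
    by (rule bexI[OF bexI[OF ballI
            sum[OF prod[OF f(1) g(2)] prod[OF f(2) g(1)]]] sum[OF prod[OF f(1) g(1)] prod[OF f(2) g(2)]]])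
       (simp add: f g prod fixed_points_sum[OF assms(1)] fixed_points_prod[OF assms(1)]
          subgroups_of_subset algebra_simps)
qed

lemma virtual_mark_of_nat:
  assumes "group G"
  shows "virtual_mark G (\<lambda>U. int n)"
proof (induction n)
  case 0
  then show ?case using virtual_mark_diff[OF assms virtual_mark_one virtual_mark_one] assms by simp
next
  case (Suc n)
  note one = virtual_mark_one[OF assms]
  \<comment> \<open>Adding 1 is written as subtracting -1, so that closure under subtraction
    suffices.\<close>
  have "virtual_mark G (\<lambda>U. int n - ((1 - 1) - 1))"
    by (rule virtual_mark_diff[OF assms Suc virtual_mark_diff[OF assms virtual_mark_diff[OF assms one one] one]])
  then show ?case by (simp add: algebra_simps)
qed

text \<open>This polynomial in \<open>f\<close> vanishes where \<open>f\<close> takes a value from 1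
  to \<open>M\<close> and equals the factorial of \<open>M\<close> where \<open>f\<close> is
  0.\<close>

lemma virtual_mark_prod:
  assumes "group G" "virtual_mark G f"
  shows "virtual_mark G (\<lambda>U. \<Prod>a = 1..M. int a - f U)"
proof (induction M)
  case 0
  then show ?case using virtual_mark_one[OF assms(1)] by simp
next
  case (Suc M)
  have "virtual_mark G (\<lambda>U. (\<Prod>a = 1..M. int a - f U) * (int (Suc M) - f U))"
    by (rule virtual_mark_mult[OF assms(1) Suc
          virtual_mark_diff[OF assms(1) virtual_mark_of_nat[OF assms(1)] assms(2)]])
  then show ?case by simp
qed


section \<open>Marks modulo a prime\<close>

text \<open>By normality \<open>K\<close> permutes the points fixed by \<open>V\<close>. Those not
  fixed by all of \<open>K\<close> fall into orbits whose stabilizers contain \<open>V\<close>; the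
  orbit lengths divide \<open>p\<close> and differ from 1, so each is \<open>p\<close>.\<close>

lemma prime_dvd_fixed_points_diff:
  assumes "group_action K E \<phi>" "finite E" "V \<lhd> K" "prime p" "order K = p * card V" "card V \<noteq> 0"
  shows "int p dvd int (card (fixed_points V (E, \<phi>))) - int (card (fixed_points (carrier K) (E, \<phi>)))"
proof -
  interpret group_action K E \<phi> by fact
  interpret K: group K using assms(3) by (simp add: normal_def subgroup_def normal_axioms_def)
  have V: "subgroup V K" using assms(3) by (rule normal_imp_subgroup)
  note A = pre_action_group_action[OF assms(1), unfolded pre_action_def, simplified]
  define F where "F = fixed_points V (E, \<phi>) - fixed_points (carrier K) (E, \<phi>)"
  have FE: "F \<subseteq> E" by (auto simp: F_def fixed_points_def)
  have cl: "\<phi> g x \<in> F" if g: "g \<in> carrier K" and x: "x \<in> F" for g x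
  proof -
    have xE: "x \<in> E" using FE x by blast
    have "\<phi> v (\<phi> g x) = \<phi> g x" if v: "v \<in> V" for v
    proof -
      have c: "v \<in> carrier K" using V v by (rule subgroup.mem_carrier)
      \<comment> \<open>Moving \<open>v\<close> past \<open>g\<close> turns it into a conjugate,
        which lies in the normal \<open>V\<close> and so fixes \<open>x\<close>.\<close>
      have "inv\<^bsub>K\<^esub> g \<otimes>\<^bsub>K\<^esub> v \<otimes>\<^bsub>K\<^esub> g \<in> V"
        using normal.inv_op_closed1[OF assms(3) g v] .
      then have "\<phi> (inv\<^bsub>K\<^esub> g \<otimes>\<^bsub>K\<^esub> v \<otimes>\<^bsub>K\<^esub> g) x = x"
        using x by (simp add: F_def fixed_points_def)
      then have "\<phi> g x = \<phi> (g \<otimes>\<^bsub>K\<^esub> (inv\<^bsub>K\<^esub> g \<otimes>\<^bsub>K\<^esub> v \<otimes>\<^bsub>K\<^esub> g)) x"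
        using A g c xE by simp
      also have "g \<otimes>\<^bsub>K\<^esub> (inv\<^bsub>K\<^esub> g \<otimes>\<^bsub>K\<^esub> v \<otimes>\<^bsub>K\<^esub> g) = v \<otimes>\<^bsub>K\<^esub> g"
        using g c by (simp flip: K.m_assoc)
      finally show ?thesis using A g c xE by simp
    qed
    moreover have "\<phi> g x \<notin> fixed_points (carrier K) (E, \<phi>)"
    proof
      assume *: "\<phi> g x \<in> fixed_points (carrier K) (E, \<phi>)"
      have "x = \<phi> (inv\<^bsub>K\<^esub> g) (\<phi> g x)" using A g xE by (metis K.inv_closed K.l_inv)
      also have "\<dots> = \<phi> g x" using * g by (simp add: fixed_points_def)
      finally show False using * x by (simp add: F_def)
    qed
    ultimately show ?thesis using A g xE by (simp add: F_def fixed_points_def)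
  qed
  let ?\<psi> = "\<lambda>g. restrict (\<phi> g) F"
  have act: "group_action K F ?\<psi>"
    using FE cl A by (intro group_actionI K.group_axioms) (auto simp: subset_iff)
  interpret F: group_action K F ?\<psi> by (rule act)
  have "card b = p" if "b \<in> orbits K F ?\<psi>" for b
  proof -
    obtain x where x: "x \<in> F" "b = orbit K ?\<psi> x" using \<open>b \<in> _\<close> by (auto simp: orbits_def)
    let ?St = "stabilizer K ?\<psi> x"
    have orb: "card b * card ?St = p * card V"
      using F.orbit_stabilizer_theorem[OF x(1)] assms(5) x(2) by simp
    have St: "subgroup ?St K" using F.stabilizer_subgroup[OF x(1)] .
    have "V \<subseteq> ?St"
      using x(1) subgroup.subset[OF V] by (auto simp: F_def fixed_points_def stabilizer_def)
    then have "subgroup V (K\<lparr>carrier := ?St\<rparr>)"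
      using K.subgroup_incl[OF V St] by blast
    then have "card (rcosets\<^bsub>K\<lparr>carrier := ?St\<rparr>\<^esub> V) * card V = card ?St"
      using group.lagrange[OF subgroup.subgroup_is_group[OF St K.group_axioms], of V]
      by (simp add: order_def)
    then obtain c where "card ?St = c * card V" by metis
    then have "card b * c = p" using orb assms(6) by simp
    then have "card b dvd p" by auto
    moreover have "card b \<noteq> 1"
    proof
      assume "card b = 1"
      then have *: "card ?St = order K" using orb assms(5) by simp
      \<comment> \<open>Infinite groups have \<open>order\<close> 0, which the nonzero
        \<open>card V\<close> excludes.\<close>
      have "finite (carrier K)"
        using assms(4-6) K.order_gt_0_iff_finite prime_gt_0_nat by simp
      then have "?St = carrier K"
        using * subgroup.subset[OF St] by (intro card_subset_eq) (auto simp: order_def)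
      then have "x \<in> fixed_points (carrier K) (E, \<phi>)"
        using x(1) FE by (auto simp: stabilizer_def fixed_points_def)
      then show False using x(1) by (simp add: F_def)
    qed
    ultimately show ?thesis using assms(4) by (auto simp: prime_nat_iff)
  qed
  then have "card F = p * card (orbits K F ?\<psi>)"
    using F.disjoint_sum[of "\<lambda>_. 1::nat"] finite_subset[OF FE assms(2)]
    by (simp add: mult.commute)
  moreover have "card (fixed_points V (E, \<phi>)) = card F + card (fixed_points (carrier K) (E, \<phi>))"
  proof -
    have "fixed_points (carrier K) (E, \<phi>) \<subseteq> fixed_points V (E, \<phi>)"
      using subgroup.subset[OF V] by (auto simp: fixed_points_def)
    moreover have "finite (fixed_points V (E, \<phi>))"
      using assms(2) by (simp add: fixed_points_def)
    ultimately show ?thesis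
      unfolding F_def by (metis card_Diff_subset card_mono finite_subset le_add_diff_inverse2)
  qed
  ultimately show ?thesis by simp
qed

text \<open>Induction on the order makes a noncyclic \<open>H\<close> minimal, so its proper
  subgroups are cyclic and hence abelian. A normal \<open>N\<close> of prime index then has value 1
  against 0 at \<open>H\<close>, contradicting the congruence.\<close>

lemma (in group) cyclic_if_virtual_mark:
  assumes "finite (carrier G)"
    and "virtual_mark G (\<lambda>U. if U \<in> cyclic_subgroups G then 1 else 0)"
    and "subgroup H G"
  shows "H \<in> cyclic_subgroups G"
  using assms(3)
proof (induction "card H" arbitrary: H rule: less_induct)
  case less
  let ?K = "G\<lparr>carrier := H\<rparr>"
  interpret K: group ?K using subgroup.subgroup_is_group[OF less.prems is_group] .
  have finH: "finite H" using subgroup.subset[OF less.prems] assms(1) finite_subset by blast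
  show ?case
  proof (rule ccontr)
    assume H: "H \<notin> cyclic_subgroups G"
    then have ncyc: "\<not> cyclic_group ?K"
      using less.prems by (simp add: cyclic_subgroups_def subgroups_of_def)
    have "\<not> trivial_group ?K" using ncyc trivial_imp_cyclic_group by blast
    then have "order ?K \<noteq> 1"
      using K.order_one_triv_iff K.group_axioms by (auto simp: trivial_group_def)
    moreover have "x \<otimes>\<^bsub>?K\<^esub> y = y \<otimes>\<^bsub>?K\<^esub> x"
      if J: "subgroup J ?K" "J \<noteq> carrier ?K" and xy: "x \<in> J" "y \<in> J" for J x y
    proof -
      have JG: "subgroup J G" using incl_subgroup[OF less.prems J(1)] .
      have "J \<subset> H" using subgroup.subset[OF J(1)] J(2) by auto
      then have "J \<in> cyclic_subgroups G"
        using less.hyps[OF _ JG] psubset_card_mono[OF finH] by blast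
      then have "comm_group (G\<lparr>carrier := J\<rparr>)"
        using subgroup.subgroup_is_group[OF JG is_group]
        by (auto simp: cyclic_subgroups_def intro: group.cyclic_imp_abelian_group)
      then show ?thesis
        using comm_groupE(4)[of "G\<lparr>carrier := J\<rparr>" x y] xy by simp
    qed
    ultimately obtain N p where N: "N \<lhd> ?K" "prime p" "order ?K = p * card N"
      using K.ex_normal_prime_index finH by auto
    have NK: "subgroup N ?K" using N(1) by (rule normal_imp_subgroup)
    have NG: "subgroup N G" using incl_subgroup[OF less.prems NK] .
    have "finite N" "N \<noteq> {}"
      using finite_subset[OF subgroup.subset[OF NG] assms(1)] subgroup.one_closed[OF NG] by auto
    then have cN: "card N \<noteq> 0" by simp
    then have "card N < card H"
      using N(3) prime_gt_1_nat[OF N(2)] by (simp add: order_def)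
    then have Ncyc: "N \<in> cyclic_subgroups G" using less.hyps NG by blast
    obtain S T where ST: "S \<in> gsets G" "T \<in> gsets G" "\<And>U. U \<in> subgroups_of G \<Longrightarrow>
        (if U \<in> cyclic_subgroups G then 1 else 0) =
          int (card (fixed_points U S)) - int (card (fixed_points U T))"
      using assms(2) unfolding virtual_mark_iff[OF is_group] by blast
    have dvd: "int p dvd int (card (fixed_points N X)) - int (card (fixed_points H X))"
      if X: "X \<in> gsets G" for X
    proof -
      obtain E \<phi> where E: "X = (E, \<phi>)" "finite E" "group_action G E \<phi>"
        using X by (auto simp: gsets_def)
      show ?thesis
        \<comment> \<open>The congruence is applied to the action of \<open>G\<close> restricted to
          \<open>H\<close>.\<close>
        using prime_dvd_fixed_points_diff[OF group_action.induced_action[OF E(3) less.prems] E(2) N cN]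
        by (simp add: E(1))
    qed
    have "1 = int (card (fixed_points N S)) - int (card (fixed_points N T))"
      using ST(3)[of N] Ncyc NG by (simp add: subgroups_of_def)
    moreover have "0 = int (card (fixed_points H S)) - int (card (fixed_points H T))"
      using ST(3)[of H] H less.prems by (simp add: subgroups_of_def)
    ultimately have "(int (card (fixed_points N S)) - int (card (fixed_points H S))) -
        (int (card (fixed_points N T)) - int (card (fixed_points H T))) = 1"
      by simp
    then have "int p dvd 1" using dvd_diff[OF dvd[OF ST(1)] dvd[OF ST(2)]] by metis
    then show False using N(2) by simp
  qed
qed


section \<open>Existence of the Artin exponent\<close>

text \<open>The least positive power of \<open>x\<close> in \<open>U\<close> generates
  \<open>U\<close> by division with remainder; if there is none, \<open>U\<close> is
  trivial.\<close>

lemma (in group) subgroup_of_cyclic_group: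
  assumes "cyclic_group G" "subgroup U G"
  shows "cyclic_group (G\<lparr>carrier := U\<rparr>)"
proof -
  interpret U: group "G\<lparr>carrier := U\<rparr>"
    using subgroup.subgroup_is_group[OF assms(2) is_group] .
  obtain x where x: "x \<in> carrier G" "carrier G = range (\<lambda>n::int. x [^] n)"
    using assms(1) by (auto simp: cyclic_group)
  have pow: "y [^] n \<in> U" if "y \<in> U" for y and n :: int
    using subgroup_int_pow_closed[OF assms(2) that] .
  have "\<exists>y \<in> U. U \<subseteq> range (\<lambda>n::int. y [^] n)"
  proof (cases "\<exists>d::nat. d > 0 \<and> x [^] int d \<in> U")
    case True
    define d where "d = (LEAST d::nat. d > 0 \<and> x [^] int d \<in> U)"
    have d: "d > 0" "x [^] int d \<in> U" using LeastI_ex[OF True] by (simp_all add: d_def)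
    have "u \<in> range (\<lambda>n::int. (x [^] int d) [^] n)" if u: "u \<in> U" for u
    proof -
      obtain n :: int where n: "u = x [^] n"
        using u x(2) subgroup.subset[OF assms(2)] by blast
      have split: "x [^] n = (x [^] int d) [^] (n div int d) \<otimes> x [^] (n mod int d)"
        using x(1) by (simp add: int_pow_pow flip: int_pow_mult)
      let ?y = "(x [^] int d) [^] (n div int d)"
      have y: "?y \<in> U" using pow[OF d(2)] .
      have "x [^] (n mod int d) = inv ?y \<otimes> u"
        using split n x(1) by (simp add: inv_solve_left flip: m_assoc)
      also have "\<dots> \<in> U"
        using subgroup.m_closed[OF assms(2) subgroup.m_inv_closed[OF assms(2) y] u] .
      finally have "x [^] int (nat (n mod int d)) \<in> U" using d(1) by simp
      moreover have "nat (n mod int d) < d" using d(1) by (simp add: nat_less_iff)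
      ultimately have "nat (n mod int d) = 0"
        using not_less_Least[of "nat (n mod int d)" "\<lambda>d. d > 0 \<and> x [^] int d \<in> U"]
        by (auto simp flip: d_def)
      then have "n mod int d = 0" using d(1) pos_mod_sign[of "int d" n] by linarith
      then show ?thesis using split n x(1) by auto
    qed
    then show ?thesis using d(2) by blast
  next
    case False
    have "u = \<one>" if u: "u \<in> U" for u
    proof -
      obtain n :: int where n: "u = x [^] n"
        using u x(2) subgroup.subset[OF assms(2)] by blast
      \<comment> \<open>Closure under inverses allows a negative exponent to be replaced by its
        absolute value.\<close>
      have "x [^] int (nat \<bar>n\<bar>) \<in> U"
        using u x(1) subgroup.m_inv_closed[OF assms(2) u] by (auto simp: n int_pow_neg abs_if)
      then have "n = 0" using False by (metis nat_eq_iff2 neq0_conv abs_0_eq abs_ge_zero nat_0_iff order_antisym)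
      then show ?thesis using n by simp
    qed
    then have "U \<subseteq> range (\<lambda>n::int. \<one> [^] n)" by auto
    then show ?thesis using subgroup.one_closed[OF assms(2)] by blast
  qed
  then obtain y where y: "y \<in> U" "U = range (\<lambda>n::int. y [^] n)" using pow by blast
  \<comment> \<open>Powers taken in \<open>U\<close> agree with powers taken in
    \<open>G\<close>.\<close>
  from y(2) have "U = range (\<lambda>n::int. y [^]\<^bsub>G\<lparr>carrier := U\<rparr>\<^esub> n)"
    unfolding int_pow_consistent[OF assms(2) y(1)] .
  then have "carrier (G\<lparr>carrier := U\<rparr>) = range (\<lambda>n::int. y [^]\<^bsub>G\<lparr>carrier := U\<rparr>\<^esub> n)"
    by (rule trans[rotated]) simp
  moreover have "y \<in> carrier (G\<lparr>carrier := U\<rparr>)" using y(1) by simp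
  ultimately show ?thesis unfolding U.cyclic_group by (rule bexI)
qed

lemma (in group) cyclic_subgroups_mono:
  assumes "C \<in> cyclic_subgroups G" "subgroup U G" "U \<subseteq> C"
  shows "U \<in> cyclic_subgroups G"
proof -
  have C: "subgroup C G" "cyclic_group (G\<lparr>carrier := C\<rparr>)"
    using assms(1) by (auto simp: cyclic_subgroups_def subgroups_of_def)
  interpret C: group "G\<lparr>carrier := C\<rparr>"
    using subgroup.subgroup_is_group[OF C(1) is_group] .
  show ?thesis
    using C.subgroup_of_cyclic_group[OF C(2) subgroup_incl[OF assms(2) C(1) assms(3)]] assms(2)
    by (simp add: cyclic_subgroups_def subgroups_of_def)
qed

text \<open>The left cosets of all cyclic subgroups, under left translation. If \<open>U\<close>
  fixes the coset of \<open>C\<close> at \<open>g\<close>, then a conjugate of \<open>U\<close> lies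
  in \<open>C\<close>, so \<open>U\<close> is cyclic; a cyclic \<open>U\<close> fixes itself as a
  coset.\<close>

lemma (in group) gset_with_cyclic_stabilizers:
  assumes "finite (carrier G)"
  obtains S where "S \<in> gsets G"
    "\<And>U. U \<in> subgroups_of G \<Longrightarrow> fixed_points U S \<noteq> {} \<longleftrightarrow> U \<in> cyclic_subgroups G"
proof -
  define E where "E = (\<lambda>(g, C). g <# C) ` (carrier G \<times> cyclic_subgroups G)"
  define \<phi> where "\<phi> = (\<lambda>g. \<lambda>A \<in> E. g <# A)"
  have cycs: "subgroup C G" "C \<subseteq> carrier G" if "C \<in> cyclic_subgroups G" for C
    using that subgroups_of_subset by (auto simp: cyclic_subgroups_def subgroups_of_def)
  have Esub: "A \<subseteq> carrier G" if "A \<in> E" for A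
    using that cycs(2) l_coset_subset_G unfolding E_def by blast
  have "finite E"
    by (rule finite_subset[of _ "Pow (carrier G)"]) (use assms Esub in auto)
  have cl: "g <# A \<in> E" if g: "g \<in> carrier G" and A: "A \<in> E" for g A
  proof -
    obtain h C where "h \<in> carrier G" "C \<in> cyclic_subgroups G" "A = h <# C"
      using A by (auto simp: E_def)
    then show ?thesis
      using g cycs lcos_m_assoc[of C g h] by (force simp: E_def)
  qed
  have act: "group_action G E \<phi>"
    using cl Esub by (intro group_actionI is_group) (auto simp: \<phi>_def lcos_m_assoc lcos_mult_one)
  obtain S where S: "S \<in> gsets G" "gset_iso G (E, \<phi>) S"
    using gset_on_nat[OF is_group \<open>finite E\<close> act] by blast
  have "fixed_points U S \<noteq> {} \<longleftrightarrow> U \<in> cyclic_subgroups G" if U: "U \<in> subgroups_of G" for U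
  proof -
    have sub: "subgroup U G" "U \<subseteq> carrier G"
      using U subgroups_of_subset by (auto simp: subgroups_of_def)
    have "finite (fixed_points U S)" "finite (fixed_points U (E, \<phi>))"
      using S(1) \<open>finite E\<close> by (auto simp: gsets_def fixed_points_def)
    then have "fixed_points U S \<noteq> {} \<longleftrightarrow> fixed_points U (E, \<phi>) \<noteq> {}"
      using fixed_points_iso[OF sub(2) S(2) pre_action_group_action[OF act]]
      by (metis card_0_eq)
    also have "\<dots> \<longleftrightarrow> U \<in> cyclic_subgroups G"
    proof
      assume "fixed_points U (E, \<phi>) \<noteq> {}"
      then obtain g C where gC: "g \<in> carrier G" "C \<in> cyclic_subgroups G"
        and fixed: "\<And>u. u \<in> U \<Longrightarrow> u <# (g <# C) = g <# C"
        by (auto simp: fixed_points_def \<phi>_def E_def)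
      let ?V = "inv g <# U #> inv (inv g)"
      have "inv g \<otimes> u \<otimes> g \<in> C" if u: "u \<in> U" for u
      proof -
        have c: "u \<in> carrier G" using sub(2) u by blast
        \<comment> \<open>Following the representative \<open>g\<close> is enough: its translate by
          \<open>u\<close> stays in the coset, which places the conjugate of \<open>u\<close> in
          \<open>C\<close>.\<close>
        have "g \<in> g <# C"
          using gC(1) subgroup.one_closed[OF cycs(1)[OF gC(2)]] by (force simp: l_coset_def)
        then have "u \<otimes> g \<in> g <# C" using fixed[OF u] by (force simp: l_coset_def)
        then obtain c where "c \<in> C" "u \<otimes> g = g \<otimes> c" by (auto simp: l_coset_def)
        then show ?thesis
          using gC(1) c cycs(2)[OF gC(2)] by (simp add: m_assoc subset_iff) (simp flip: m_assoc)
      qed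
      then have "?V \<subseteq> C" using gC(1) unfolding conj_eq_image by auto
      moreover have "subgroup ?V G"
        using subgroup_conjugation_is_surj2[OF _ sub(1)] gC(1) by blast
      ultimately have "?V \<in> cyclic_subgroups G"
        using cyclic_subgroups_mono[OF gC(2)] by blast
      then show "U \<in> cyclic_subgroups G"
        using cyclic_subgroups_conj[OF is_group U inv_closed[OF gC(1)]] by blast
    next
      assume "U \<in> cyclic_subgroups G"
      then have "U \<in> E" using lcos_mult_one[OF sub(2)] by (force simp: E_def)
      moreover have "u <# U = U" if "u \<in> U" for u
        using that sub(1) by (metis lcos_mult_one l_repr_independence one_closed sub(2))
      ultimately show "fixed_points U (E, \<phi>) \<noteq> {}"
        by (auto simp: fixed_points_def \<phi>_def)
    qed
    finally show ?thesis .
  qed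
  then show thesis using that S(1) by blast
qed

lemma (in group) artin_element_exists:
  assumes "finite (carrier G)"
  shows "\<exists>n \<ge> 1. artin_element G (cyclic_subgroups G) n \<in> burnside_image G"
proof -
  obtain S where S: "S \<in> gsets G"
    "\<And>U. U \<in> subgroups_of G \<Longrightarrow> fixed_points U S \<noteq> {} \<longleftrightarrow> U \<in> cyclic_subgroups G"
    using gset_with_cyclic_stabilizers[OF assms] by blast
  \<comment> \<open>The size of the whole set bounds every number of fixed points.\<close>
  define M where "M = card (fst S)"
  let ?f = "\<lambda>U. int (card (fixed_points U S))"
  have fin: "finite (fst S)" using S(1) by (auto simp: gsets_def)
  have "virtual_mark G (\<lambda>U. int (fact M) - (\<Prod>a = 1..M. int a - ?f U))"
    by (intro virtual_mark_diff virtual_mark_of_nat virtual_mark_prod virtual_mark_card is_group S(1))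
  moreover have "int (fact M) - (\<Prod>a = 1..M. int a - ?f U) =
      (if U \<in> cyclic_subgroups G then int (fact M) else 0)" if U: "U \<in> subgroups_of G" for U
  proof (cases "U \<in> cyclic_subgroups G")
    case True
    have sub: "fixed_points U S \<subseteq> fst S" by (auto simp: fixed_points_def split: prod.splits)
    then have "card (fixed_points U S) \<in> {1..M}"
      using True S(2)[OF U] card_mono[OF fin sub] finite_subset[OF sub fin]
      by (simp add: M_def Suc_le_eq card_gt_0_iff)
    \<comment> \<open>The factor whose index \<open>a\<close> is the number of fixed points
      vanishes.\<close>
    then have "(\<Prod>a = 1..M. int a - ?f U) = 0" by (subst prod_zero_iff) auto
    then show ?thesis using True by simp
  next
    case False
    \<comment> \<open>There are no fixed points here, so the product is the factorial
      itself.\<close>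
    then show ?thesis using S(2)[OF U] by (simp add: fact_prod)
  qed
  then have "restrict (\<lambda>U. int (fact M) - (\<Prod>a = 1..M. int a - ?f U)) (subgroups_of G) =
      artin_element G (cyclic_subgroups G) (fact M)"
    unfolding artin_element_def by (rule restrict_ext)
  ultimately have "artin_element G (cyclic_subgroups G) (fact M) \<in> burnside_image G"
    by (simp only: virtual_mark_def)
  then show ?thesis using fact_ge_1 by blast
qed

section \<open>Artin exponent one and cyclic groups\<close>

theorem theorem4p1:
  fixes G :: "('a, 'm) monoid_scheme"
  assumes "group G" and "finite (carrier G)"
  shows "artin_exponent G (cyclic_subgroups G) = 1 \<longleftrightarrow> cyclic_group G"
proof
  interpret group G by fact
  assume "artin_exponent G (cyclic_subgroups G) = 1"
  then have "artin_element G (cyclic_subgroups G) 1 \<in> burnside_image G"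
    \<comment> \<open>Only because some admissible \<open>n\<close> exists does the least one
      satisfy the defining condition.\<close>
    using LeastI_ex[OF artin_element_exists[OF assms(2), simplified Bex_def]]
    unfolding artin_exponent_def by metis
  then have "virtual_mark G (\<lambda>U. if U \<in> cyclic_subgroups G then 1 else 0)"
    by (simp add: virtual_mark_def artin_element_def cong: if_cong)
  then have "carrier G \<in> cyclic_subgroups G"
    using cyclic_if_virtual_mark[OF assms(2) _ subgroup_self] by blast
  then show "cyclic_group G" by (simp add: cyclic_subgroups_def)
next
  interpret group G by fact
  assume "cyclic_group G"
  then have G: "carrier G \<in> cyclic_subgroups G"
    using subgroup_self by (simp add: cyclic_subgroups_def subgroups_of_def)
  have "U \<in> cyclic_subgroups G" if "U \<in> subgroups_of G" for U
    using that cyclic_subgroups_mono[OF G _ subgroups_of_subset] by (simp add: subgroups_of_def)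
  \<comment> \<open>All subgroups being cyclic, the element is the unit of the ghost ring, given by
    the one-point set.\<close>
  then have "artin_element G (cyclic_subgroups G) 1 = restrict (\<lambda>U. 1) (subgroups_of G)"
    unfolding artin_element_def by (intro restrict_ext) simp
  then have "artin_element G (cyclic_subgroups G) 1 \<in> burnside_image G"
    using virtual_mark_one[OF assms(1)] by (simp add: virtual_mark_def)
  then show "artin_exponent G (cyclic_subgroups G) = 1"
    unfolding artin_exponent_def by (intro Least_equality) auto
qed

end
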